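(* Let $C$ be an $(n,k)$-code and $L\ge1$. For any $d\in\{0,\dots,n-k\}$, $C$ is $\operatorname{rLD-MDS}_d(\le L)$ if and only if the dual code $C^\perp$ is $\operatorname{rMDS}_d(L+1)$.
   Context: An $(n,k)$-code is a $k$-dimensional subspace of $\mathbb F^n$; a generator matrix is a $k\times n$ matrix whose rows form a basis. For a matrix $V$ and $A\subseteq[n]$, $V|_A$ denotes the columns indexed by $A$ and $V_A$ their span. For $A_1,\dots,A_\ell\subseteq[n]$, $\mathcal G_{A_1,\dots,A_\ell}[V]$ (for $V$ with $k'$ rows) is the $\ell k'\times(k'+\sum|A_i|)$ block matrix whose $i$-th block row has $I_{k'}$ in the first block column and $V|_{A_i}$ in block column $i+1$, zeros elsewhere. A generic $m\times n$ matrix has independent indeterminates as entries. An $(n,k)$-code $C$ with generator matrix $G$ is $\operatorname{rMDS}_d(\ell)$ ($\ell\ge2$, $0\le d\le k$) if $\mathcal G_{A_1,\dots,A_\ell}[G]$ has full column rank whenever $\mathcal G_{A_1,\dots,A_\ell}[W]$ has full column rank, $W$ a generic $(k-d)\times n$ matrix. A code $C$ is $(\rho,L)$ average-radius list-decodable if for every $y\in\mathbb F^n$ and every $L+1$ distinct codewords $c_0,\dots,c_L$ we have $\frac{1}{L+1}\sum_i\operatorname{wt}(y-c_i)>\rho n$ (Hamming weight). $C$ is $\operatorname{rLD-MDS}_d(L)$ if it is $(\rho,L)$ average-radius list-decodable with $\rho=\frac{L}{L+1}\frac{n-k-d}{n}$, and $\operatorname{rLD-MDS}_d(\le L)$ if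 it is $\operatorname{rLD-MDS}_d(\ell)$ for all $\ell\in\{1,\dots,L\}$. *)

theory Defs
  imports Complex_Main "HOL-Library.Poly_Mapping" "HOL-Library.Product_Lexorder"
    "HOL-Computational_Algebra.Fraction_Field"
begin

text \<open>Vectors in F^n are functions nat => F vanishing outside {0..<n};
  matrices are functions (row index) => (column index) => F.\<close>

definition vecs :: "nat \<Rightarrow> (nat \<Rightarrow> 'a::zero) set" where
  "vecs n = {v. \<forall>j. n \<le> j \<longrightarrow> v j = 0}"

definition gen_matrix :: "nat \<Rightarrow> nat \<Rightarrow> (nat \<Rightarrow> nat \<Rightarrow> 'a::field) \<Rightarrow> (nat \<Rightarrow> 'a) set \<Rightarrow> bool" where
  "gen_matrix n k G C \<longleftrightarrow>
     (\<forall>u. (\<forall>j<n. (\<Sum>r<k. u r * G r j) = 0) \<longrightarrow> (\<forall>r<k. u r = 0)) \<and>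
     C = {(\<lambda>j. if j < n then (\<Sum>r<k. u r * G r j) else 0) | u. True}"

definition is_code :: "nat \<Rightarrow> nat \<Rightarrow> (nat \<Rightarrow> 'a::field) set \<Rightarrow> bool" where
  "is_code n k C \<longleftrightarrow> (\<exists>G. gen_matrix n k G C)"

definition dual_code :: "nat \<Rightarrow> (nat \<Rightarrow> 'a::field) set \<Rightarrow> (nat \<Rightarrow> 'a) set" where
  "dual_code n C = {y \<in> vecs n. \<forall>c\<in>C. (\<Sum>j<n. c j * y j) = 0}"

definition full_col_rank :: "'r set \<Rightarrow> 'c set \<Rightarrow> ('r \<Rightarrow> 'c \<Rightarrow> 'a::field) \<Rightarrow> bool" where
  "full_col_rank R Cs M \<longleftrightarrow>
     (\<forall>x. (\<forall>r\<in>R. (\<Sum>c\<in>Cs. M r c * x c) = 0) \<longrightarrow> (\<forall>c\<in>Cs. x c = 0))"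

text \<open>The block matrix G_{A_1,...,A_l}[V] for V with k' rows.
  Rows are indexed by (i, r) with i < l (block row i+1), r < k'.
  Columns: Inl r (r < k') for the first block column, Inr (i, a) with a in A i
  for block column i+2 (columns of V restricted to A i).\<close>
definition blk_rows :: "nat \<Rightarrow> nat \<Rightarrow> (nat \<times> nat) set" where
  "blk_rows l k' = {(i, r). i < l \<and> r < k'}"

definition blk_cols :: "nat \<Rightarrow> nat \<Rightarrow> (nat \<Rightarrow> nat set) \<Rightarrow> (nat + nat \<times> nat) set" where
  "blk_cols l k' A = Inl ` {..<k'} \<union> Inr ` {(i, a). i < l \<and> a \<in> A i}"

definition blk_mat :: "(nat \<Rightarrow> nat \<Rightarrow> 'a::field) \<Rightarrow> nat \<times> nat \<Rightarrow> nat + nat \<times> nat \<Rightarrow> 'a" where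
  "blk_mat V = (\<lambda>(i, r) col. case col of
       Inl r' \<Rightarrow> (if r = r' then 1 else 0)
     | Inr (i', a) \<Rightarrow> (if i = i' then V r a else 0))"

definition blk_full_rank :: "nat \<Rightarrow> nat \<Rightarrow> (nat \<Rightarrow> nat set) \<Rightarrow> (nat \<Rightarrow> nat \<Rightarrow> 'a::field) \<Rightarrow> bool" where
  "blk_full_rank l k' A V \<longleftrightarrow> full_col_rank (blk_rows l k') (blk_cols l k' A) (blk_mat V)"

text \<open>Generic matrix: entry (r, a) is the indeterminate X_(r,a), viewed in the
  rational function field F(X) = fraction field of the multivariate polynomial
  ring F[X_(r,a)] (polynomials as finitely supported maps monomial => coefficient).\<close>
type_synonym 'a ratfun = "(((nat \<times> nat) \<Rightarrow>\<^sub>0 nat) \<Rightarrow>\<^sub>0 'a) fract"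

definition generic_mat :: "nat \<Rightarrow> nat \<Rightarrow> 'a::field ratfun" where
  "generic_mat r a = Fract (Poly_Mapping.single (Poly_Mapping.single (r, a) 1) 1) 1"

text \<open>rMDS_d(l) for an (n,k)-code C (with respect to any generator matrix; the
  property does not depend on the choice).\<close>
definition rMDS :: "'a itself \<Rightarrow> nat \<Rightarrow> nat \<Rightarrow> nat \<Rightarrow> nat \<Rightarrow> (nat \<Rightarrow> 'a::field) set \<Rightarrow> bool" where
  "rMDS _ n k d l C \<longleftrightarrow>
     (\<forall>G A. gen_matrix n k G C \<longrightarrow> (\<forall>i<l. A i \<subseteq> {..<n}) \<longrightarrow>
        blk_full_rank l (k - d) A (generic_mat :: nat \<Rightarrow> nat \<Rightarrow> 'a ratfun) \<longrightarrow>
        blk_full_rank l k A G)"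

definition wt :: "nat \<Rightarrow> (nat \<Rightarrow> 'a::zero) \<Rightarrow> nat" where
  "wt n v = card {j. j < n \<and> v j \<noteq> 0}"

definition avg_list_dec :: "nat \<Rightarrow> real \<Rightarrow> nat \<Rightarrow> (nat \<Rightarrow> 'a::ab_group_add) set \<Rightarrow> bool" where
  "avg_list_dec n \<rho> L C \<longleftrightarrow>
     (\<forall>y \<in> vecs n. \<forall>c. (\<forall>i\<le>L. c i \<in> C) \<longrightarrow> inj_on c {..L} \<longrightarrow>
        (\<Sum>i\<le>L. real (wt n (\<lambda>j. y j - c i j))) / real (L + 1) > \<rho> * real n)"

definition rLD_MDS :: "nat \<Rightarrow> nat \<Rightarrow> nat \<Rightarrow> nat \<Rightarrow> (nat \<Rightarrow> 'a::field) set \<Rightarrow> bool" where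
  "rLD_MDS n k d L C \<longleftrightarrow>
     avg_list_dec n (real L / real (L + 1) * ((real n - real k - real d) / real n)) L C"

definition rLD_MDS_le :: "nat \<Rightarrow> nat \<Rightarrow> nat \<Rightarrow> nat \<Rightarrow> (nat \<Rightarrow> 'a::field) set \<Rightarrow> bool" where
  "rLD_MDS_le n k d L C \<longleftrightarrow> (\<forall>l\<in>{1..L}. rLD_MDS n k d l C)"

end

theory Submission
  imports Defs
begin

text \<open>
  Write \<open>m = n - k - d\<close> and let \<open>H\<close> be a parity check matrix of \<open>C\<close>. A kernel vector of the block
  matrix over \<open>H\<close> is a family of vectors \<open>y\<^sub>i\<close> supported on \<open>A\<^sub>i\<close> with a common syndrome, that is, the
  differences \<open>y - c\<^sub>i\<close> of one word \<open>y\<close> to codewords \<open>c\<^sub>i\<close>.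

  If \<open>C\<close> is list decodable and such a family is nonzero, merge the blocks carrying equal \<open>y\<^sub>i\<close>. The
  distinct values violate a dimension count for the merged generic block matrix.

  Conversely, take a violation of list decodability with the fewest codewords. Minimality, applied
  after correcting the errors common to a set \<open>P\<close> of codewords, gives
  \<open>(|P| - 1) m + |\<Inter>\<^sub>P A\<^sub>i| \<le> \<Sum>\<^sub>P |A\<^sub>i|\<close> for every proper \<open>P\<close>. Hence the \<open>m\<close> rows can be distributed
  over the blocks, at most \<open>m - |A\<^sub>i|\<close> of them to block \<open>i\<close>, so that \<open>\<Inter>\<^sub>P A\<^sub>i\<close> and the rows of \<open>P\<close> together
  number at most \<open>m\<close>. Setting the indeterminates \<open>X\<^sub>r\<^sub>a\<close> with \<open>a \<in> A\<^sub>i\<close> to zero in the rows \<open>r\<close>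
  of block \<open>i\<close> forces the common syndrome to vanish, and Hall's theorem makes the columns in each
  \<open>A\<^sub>i\<close> independent. So the generic block matrix has full rank, whereas the one over \<open>H\<close> does not.
\<close>

section \<open>Hall's theorem and homogeneous linear systems\<close>

text \<open>Halmos-Vaughan induction. If a proper nonempty \<open>J\<close> attains Hall's bound,
  \<open>J\<close> and \<open>I - J\<close> are matched separately; if none does, one element is
  matched freely, because losing its partner costs any other set at most one neighbour.\<close>

lemma hall_marriage:
  assumes "finite I" and "\<And>i. i \<in> I \<Longrightarrow> finite (N i)"
    and "\<And>J. J \<subseteq> I \<Longrightarrow> card J \<le> card (\<Union>i\<in>J. N i)"
  shows "\<exists>\<sigma>. inj_on \<sigma> I \<and> (\<forall>i\<in>I. \<sigma> i \<in> N i)"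
  using assms
proof (induction "card I" arbitrary: I N rule: less_induct)
  case less
  note fin = less.prems(1,2) and hall = less.prems(3)
  have finU: "finite (\<Union>i\<in>J. N i)" if "J \<subseteq> I" for J
    using that fin by (meson finite_UN_I finite_subset subsetD)
  consider (empty) "I = {}"
    | (tight) J where "J \<noteq> {}" "J \<subset> I" "card (\<Union>i\<in>J. N i) = card J"
    | (slack) "I \<noteq> {}" "\<And>J. J \<noteq> {} \<Longrightarrow> J \<subset> I \<Longrightarrow> card J < card (\<Union>i\<in>J. N i)"
    using hall by (metis (no_types) order_le_less psubset_imp_subset)
  then show ?case
  proof cases
    case empty
    then show ?thesis by simp
  next
    case (tight J)
    let ?U = "\<Union>i\<in>J. N i"
    have finJ: "finite J" using tight fin(1) by (meson finite_subset psubset_imp_subset)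
    have "\<exists>\<sigma>. inj_on \<sigma> J \<and> (\<forall>i\<in>J. \<sigma> i \<in> N i)"
    proof (rule less.hyps)
      show "card J < card I" using tight fin(1) by (simp add: psubset_card_mono)
    qed (use tight fin hall finJ in auto)
    then obtain \<sigma>1 where s1: "inj_on \<sigma>1 J" "\<forall>i\<in>J. \<sigma>1 i \<in> N i" by blast
    have "\<exists>\<sigma>. inj_on \<sigma> (I - J) \<and> (\<forall>i\<in>I - J. \<sigma> i \<in> N i - ?U)"
    proof (rule less.hyps)
      show "card (I - J) < card I"
        using tight fin(1) by (intro psubset_card_mono) auto
      fix K assume K: "K \<subseteq> I - J"
      have finK: "finite K" using K fin(1) by (meson finite_Diff finite_subset)
      have sub: "K \<union> J \<subseteq> I" using K tight by blast
      \<comment> \<open>Hall's condition for \<open>K \<union> J\<close>, less the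
        \<open>card J\<close> neighbours of the tight set, leaves enough neighbours of
        \<open>K\<close> outside \<open>?U\<close>.\<close>
      have "card K + card J = card (K \<union> J)"
        using K finK finJ by (subst card_Un_disjoint) auto
      also have "\<dots> \<le> card (\<Union>i\<in>K \<union> J. N i)" using hall[OF sub] .
      also have "(\<Union>i\<in>K \<union> J. N i) = (\<Union>i\<in>K. N i - ?U) \<union> ?U" by auto
      also have "card \<dots> \<le> card (\<Union>i\<in>K. N i - ?U) + card ?U" by (rule card_Un_le)
      finally show "card K \<le> card (\<Union>i\<in>K. N i - ?U)" using tight by simp
    qed (use fin in auto)
    then obtain \<sigma>2 where s2: "inj_on \<sigma>2 (I - J)" "\<forall>i\<in>I - J. \<sigma>2 i \<in> N i - ?U" by blast
    let ?\<sigma> = "\<lambda>i. if i \<in> J then \<sigma>1 i else \<sigma>2 i"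
    have "inj_on ?\<sigma> I"
    proof (rule inj_onI)
      fix a b assume ab: "a \<in> I" "b \<in> I" "?\<sigma> a = ?\<sigma> b"
      have "a \<in> J \<longleftrightarrow> b \<in> J"
        using ab s1(2) s2(2) by (metis (no_types, lifting) DiffE DiffI UN_iff)
      then show "a = b"
        using ab s1(1) s2(1) by (auto simp: inj_on_def split: if_splits)
    qed
    then show ?thesis using s1(2) s2(2) by (intro exI[of _ ?\<sigma>]) auto
  next
    case slack
    then obtain i where i: "i \<in> I" by blast
    have "N i \<noteq> {}" using hall[of "{i}"] i by auto
    then obtain v where v: "v \<in> N i" by blast
    have "\<exists>\<sigma>. inj_on \<sigma> (I - {i}) \<and> (\<forall>j\<in>I - {i}. \<sigma> j \<in> N j - {v})"
    proof (rule less.hyps)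
      show "card (I - {i}) < card I" using i fin(1) by (rule card_Diff1_less[rotated])
      fix K assume K: "K \<subseteq> I - {i}"
      have eq: "(\<Union>j\<in>K. N j - {v}) = (\<Union>j\<in>K. N j) - {v}" by auto
      show "card K \<le> card (\<Union>j\<in>K. N j - {v})"
      proof (cases "K = {}")
        case False
        then have "card K < card (\<Union>j\<in>K. N j)" using K i by (intro slack(2)) auto
        then show ?thesis unfolding eq by (cases "v \<in> (\<Union>j\<in>K. N j)") (auto simp: card_Diff_singleton)
      qed simp
    qed (use fin in auto)
    then obtain \<sigma> where s: "inj_on \<sigma> (I - {i})" "\<forall>j\<in>I - {i}. \<sigma> j \<in> N j - {v}" by blast
    have "inj_on (\<sigma>(i := v)) I"
    proof (rule inj_onI)
      fix a b assume "a \<in> I" "b \<in> I" "(\<sigma>(i := v)) a = (\<sigma>(i := v)) b"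
      then show "a = b" using s by (auto simp: inj_on_def split: if_splits)
    qed
    then show ?thesis using s(2) v by (intro exI[of _ "\<sigma>(i := v)"]) auto
  qed
qed

text \<open>Gaussian elimination: a zero row is dropped, any other row is solved for a pivot
  variable \<open>p\<close>, at the cost of one equation and one unknown.\<close>

lemma underdetermined_system:
  fixes M :: "'r \<Rightarrow> 'c \<Rightarrow> 'a::field"
  assumes "finite R" and "finite Cs" and "card R < card Cs"
  shows "\<exists>x. (\<forall>r\<in>R. (\<Sum>c\<in>Cs. M r c * x c) = 0) \<and> (\<exists>c\<in>Cs. x c \<noteq> 0)"
  using assms
proof (induction R arbitrary: M Cs rule: finite_induct)
  case empty
  then show ?case by (intro exI[of _ "\<lambda>_. 1"]) (auto simp: card_gt_0_iff)
next
  case (insert r R)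
  show ?case
  proof (cases "\<forall>c\<in>Cs. M r c = 0")
    case True
    then show ?thesis using insert.IH[of Cs M] insert by auto
  next
    case False
    then obtain p where p: "p \<in> Cs" "M r p \<noteq> 0" by blast
    let ?D = "Cs - {p}"
    let ?M' = "\<lambda>q c. M q c - M q p / M r p * M r c"
    have "card R < card ?D" using insert p by simp
    then obtain x where x: "\<forall>q\<in>R. (\<Sum>c\<in>?D. ?M' q c * x c) = 0" "\<exists>c\<in>?D. x c \<noteq> 0"
      using insert.IH[of ?D ?M'] insert.prems by auto
    define s where "s = (\<Sum>c\<in>?D. M r c * x c)"
    define z where "z = x(p := - s / M r p)"
    have split: "(\<Sum>c\<in>Cs. M q c * z c) = - M q p / M r p * s + (\<Sum>c\<in>?D. M q c * x c)" for q
    proof -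
      have "(\<Sum>c\<in>Cs. M q c * z c) = M q p * z p + (\<Sum>c\<in>?D. M q c * z c)"
        using insert.prems p by (simp add: sum.remove)
      also have "(\<Sum>c\<in>?D. M q c * z c) = (\<Sum>c\<in>?D. M q c * x c)"
        by (rule sum.cong) (auto simp: z_def)
      finally show ?thesis by (simp add: z_def)
    qed
    have "(\<Sum>c\<in>Cs. M q c * z c) = 0" if "q \<in> insert r R" for q
    proof (cases "q = r")
      case True
      then show ?thesis using split[of r] p by (simp add: s_def)
    next
      case False
      then have "(\<Sum>c\<in>?D. ?M' q c * x c) = 0" using x that by blast
      moreover have "(\<Sum>c\<in>?D. ?M' q c * x c) = (\<Sum>c\<in>?D. M q c * x c) - M q p / M r p * s"
        by (simp add: s_def algebra_simps sum_subtractf sum_distrib_left)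
      ultimately show ?thesis using split[of q] by simp
    qed
    moreover have "\<exists>c\<in>Cs. z c \<noteq> 0" using x(2) by (auto simp: z_def)
    ultimately show ?thesis by blast
  qed
qed

section \<open>Specialising indeterminates to zero\<close>

definition sdeg :: "'x set \<Rightarrow> ('x \<Rightarrow>\<^sub>0 nat) \<Rightarrow> nat" where
  "sdeg S u = (\<Sum>x\<in>Poly_Mapping.keys u \<inter> S. Poly_Mapping.lookup u x)"

lemma sdeg_zero [simp]: "sdeg S 0 = 0"
  by (simp add: sdeg_def)

lemma sdeg_single: "sdeg S (Poly_Mapping.single x e) = (if x \<in> S then e else 0)"
  by (auto simp: sdeg_def)

lemma sdeg_add: "sdeg S (u + v) = sdeg S u + sdeg S v"
proof -
  let ?K = "Poly_Mapping.keys u \<union> Poly_Mapping.keys v"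
  have ext: "sdeg S w = (\<Sum>x\<in>?K \<inter> S. Poly_Mapping.lookup w x)" if "Poly_Mapping.keys w \<subseteq> ?K" for w
    unfolding sdeg_def using that
    by (intro sum.mono_neutral_left) (auto simp: in_keys_iff)
  show ?thesis
    using ext[of u] ext[of v] ext[of "u + v"] keys_add[of u v]
    by (simp add: lookup_add sum.distrib)
qed

text \<open>The homogeneous component of degree \<open>e\<close> in the grading of the polynomial
  ring by total degree in the variables of \<open>S\<close>.\<close>

definition spart :: "'x set \<Rightarrow> nat \<Rightarrow> (('x \<Rightarrow>\<^sub>0 nat) \<Rightarrow>\<^sub>0 'a::zero) \<Rightarrow> ('x \<Rightarrow>\<^sub>0 nat) \<Rightarrow>\<^sub>0 'a" where
  "spart S e p = Poly_Mapping.mapp (\<lambda>u v. v when sdeg S u = e) p"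

lemma lookup_spart: "Poly_Mapping.lookup (spart S e p) u = (Poly_Mapping.lookup p u when sdeg S u = e)"
  by (auto simp: spart_def lookup_mapp in_keys_iff when_def)

lemma spart_zero [simp]: "spart S e 0 = 0"
  by (rule poly_mapping_eqI) (simp add: lookup_spart)

lemma spart_single: "spart S e (Poly_Mapping.single u v) = (if sdeg S u = e then Poly_Mapping.single u v else 0)"
  by (rule poly_mapping_eqI) (auto simp: lookup_spart lookup_single when_def)

lemma spart_sum:
  fixes f :: "'i \<Rightarrow> ('x \<Rightarrow>\<^sub>0 nat) \<Rightarrow>\<^sub>0 'a::comm_monoid_add"
  shows "spart S e (\<Sum>i\<in>I. f i) = (\<Sum>i\<in>I. spart S e (f i))"
  by (rule poly_mapping_eqI) (simp add: lookup_spart lookup_sum when_def)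

lemma poly_mapping_sum_singles: "(\<Sum>u\<in>Poly_Mapping.keys p. Poly_Mapping.single u (Poly_Mapping.lookup p u)) = p"
  by (rule poly_mapping_eqI)
    (auto simp: lookup_sum lookup_single when_def in_keys_iff)

text \<open>A monomial is homogeneous, so multiplication by it shifts the grading. By additivity
  this need only be checked on monomials.\<close>

lemma spart_single_mult:
  fixes p :: "('x \<Rightarrow>\<^sub>0 nat) \<Rightarrow>\<^sub>0 'a::semiring_0"
  shows "spart S e (Poly_Mapping.single m b * p) =
    (if sdeg S m \<le> e then Poly_Mapping.single m b * spart S (e - sdeg S m) p else 0)"
proof -
  have "spart S e (Poly_Mapping.single m b * Poly_Mapping.single u v) =
    (if sdeg S m \<le> e then Poly_Mapping.single m b * spart S (e - sdeg S m) (Poly_Mapping.single u v) else 0)" for u v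
    by (auto simp: mult_single spart_single sdeg_add)
  then have "spart S e (Poly_Mapping.single m b * (\<Sum>u\<in>Poly_Mapping.keys p. Poly_Mapping.single u (Poly_Mapping.lookup p u))) =
    (if sdeg S m \<le> e then Poly_Mapping.single m b *
       spart S (e - sdeg S m) (\<Sum>u\<in>Poly_Mapping.keys p. Poly_Mapping.single u (Poly_Mapping.lookup p u)) else 0)"
    by (auto simp: sum_distrib_left spart_sum)
  then show ?thesis by (simp add: poly_mapping_sum_singles)
qed

lemma common_denominator:
  fixes x :: "'c \<Rightarrow> 'a::idom fract"
  assumes "finite Cs"
  shows "\<exists>q p. q \<noteq> 0 \<and> (\<forall>c\<in>Cs. x c = Fract (p c) q)"
  using assms
proof (induction Cs rule: finite_induct)
  case empty
  show ?case by (intro exI[of _ 1]) simp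
next
  case (insert c Cs)
  then obtain q p where qp: "q \<noteq> 0" "\<forall>c\<in>Cs. x c = Fract (p c) q" by blast
  obtain a b where ab: "x c = Fract a b" "b \<noteq> 0" by (cases "x c") auto
  let ?p = "\<lambda>c'. if c' = c then a * q else p c' * b"
  have "\<forall>c'\<in>insert c Cs. x c' = Fract (?p c') (q * b)"
    using qp ab insert.hyps by (auto simp: eq_fract)
  then show ?case using qp ab by (intro exI[of _ "q * b"] exI[of _ ?p]) auto
qed

lemma Fract_sum:
  fixes f :: "'i \<Rightarrow> 'a::idom"
  assumes "q \<noteq> 0"
  shows "(\<Sum>i\<in>I. Fract (f i) q) = Fract (\<Sum>i\<in>I. f i) q"
proof (induction I rule: infinite_finite_induct)
  case (insert i I)
  then show ?case using assms by (simp add: eq_fract algebra_simps)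
qed (use assms in \<open>simp_all add: Zero_fract_def eq_fract\<close>)

text \<open>Setting the variables in \<open>S\<close> to zero cannot raise the rank: the part of lowest \<open>S\<close>-degree of a
  polynomial kernel vector lies in the kernel of the specialised matrix.\<close>

lemma full_col_rank_specialise:
  fixes m :: "'r \<Rightarrow> 'c \<Rightarrow> ('x::linorder \<Rightarrow>\<^sub>0 nat)" and b :: "'r \<Rightarrow> 'c \<Rightarrow> 'a::field"
  assumes fin: "finite Cs"
    and special: "full_col_rank R Cs (\<lambda>r c.
        Fract (Poly_Mapping.single (m r c) (if sdeg S (m r c) = 0 then b r c else 0)) 1)"
  shows "full_col_rank R Cs (\<lambda>r c. Fract (Poly_Mapping.single (m r c) (b r c)) 1)"
  unfolding full_col_rank_def
proof (intro allI impI ballI)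
  fix x c0
  assume x: "\<forall>r\<in>R. (\<Sum>c\<in>Cs. Fract (Poly_Mapping.single (m r c) (b r c)) 1 * x c) = 0"
    and c0: "c0 \<in> Cs"
  obtain q p where q: "q \<noteq> 0" and p: "\<And>c. c \<in> Cs \<Longrightarrow> x c = Fract (p c) q"
    using common_denominator[OF fin, of x] by blast
  have eqn: "(\<Sum>c\<in>Cs. Poly_Mapping.single (m r c) (b r c) * p c) = 0" if "r \<in> R" for r
  proof -
    have "0 = (\<Sum>c\<in>Cs. Fract (Poly_Mapping.single (m r c) (b r c) * p c) q)"
      using x that p by (simp cong: sum.cong)
    then show ?thesis
      unfolding Fract_sum[OF q] using q by (simp add: Zero_fract_def eq_fract)
  qed
  show "x c0 = 0"
  proof (rule ccontr)
    assume "x c0 \<noteq> 0"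
    then have "p c0 \<noteq> 0" using p[OF c0] q by (auto simp: Zero_fract_def eq_fract)
    then obtain u where "Poly_Mapping.lookup (p c0) u \<noteq> 0"
      by (metis lookup_zero poly_mapping_eqI)
    then have "Poly_Mapping.lookup (spart S (sdeg S u) (p c0)) u \<noteq> 0" by (simp add: lookup_spart)
    then have ex: "\<exists>e. \<exists>c\<in>Cs. spart S e (p c) \<noteq> 0"
      using c0 by (metis lookup_zero)
    define e where "e = (LEAST e. \<exists>c\<in>Cs. spart S e (p c) \<noteq> 0)"
    have e: "\<exists>c\<in>Cs. spart S e (p c) \<noteq> 0" unfolding e_def by (rule LeastI_ex[OF ex])
    have low: "spart S e' (p c) = 0" if "e' < e" "c \<in> Cs" for e' c
      using not_less_Least[of e' "\<lambda>e. \<exists>c\<in>Cs. spart S e (p c) \<noteq> 0"] that e_def by blast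
    let ?b = "\<lambda>r c. if sdeg S (m r c) = 0 then b r c else 0"
    have "(\<Sum>c\<in>Cs. Fract (Poly_Mapping.single (m r c) (?b r c)) 1 * Fract (spart S e (p c)) 1) = 0"
      if "r \<in> R" for r
    proof -
      have "0 = spart S e (\<Sum>c\<in>Cs. Poly_Mapping.single (m r c) (b r c) * p c)"
        using eqn[OF that] by simp
      \<comment> \<open>An entry involving a variable of \<open>S\<close> can meet only components
        of \<open>p c\<close> of degree below \<open>e\<close>, which vanish by \<open>low\<close>.
        What remains are the specialised entries.\<close>
      also have "\<dots> = (\<Sum>c\<in>Cs. Poly_Mapping.single (m r c) (?b r c) * spart S e (p c))"
        unfolding spart_sum by (intro sum.cong) (auto simp: spart_single_mult low)
      finally show ?thesis by (simp add: Fract_sum Zero_fract_def)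
    qed
    then have "\<forall>c\<in>Cs. Fract (spart S e (p c)) 1 = 0"
      using special[unfolded full_col_rank_def, THEN spec[of _ "\<lambda>c. Fract (spart S e (p c)) 1"]]
      by simp
    then show False using e by (auto simp: Zero_fract_def eq_fract)
  qed
qed

section \<open>Kernels of block matrices\<close>

lemma finite_blk_cols: "\<forall>i<l. finite (A i) \<Longrightarrow> finite (blk_cols l m A)"
proof -
  assume fin: "\<forall>i<l. finite (A i)"
  have "{(i, a). i < l \<and> a \<in> A i} = (SIGMA i:{..<l}. A i)" by auto
  then show ?thesis using fin by (auto simp: blk_cols_def intro!: finite_imageI finite_SigmaI)
qed

lemma sum_blk_cols:
  fixes g :: "nat + nat \<times> nat \<Rightarrow> 'b::comm_monoid_add"
  assumes fin: "\<forall>i<l. finite (A i)"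
  shows "(\<Sum>c\<in>blk_cols l m A. g c) = (\<Sum>r<m. g (Inl r)) + (\<Sum>i<l. \<Sum>a\<in>A i. g (Inr (i, a)))"
proof -
  have eq: "{(i, a). i < l \<and> a \<in> A i} = (SIGMA i:{..<l}. A i)" by auto
  have "(\<Sum>c\<in>blk_cols l m A. g c) =
      (\<Sum>c\<in>Inl ` {..<m}. g c) + (\<Sum>c\<in>Inr ` (SIGMA i:{..<l}. A i). g c)"
    unfolding blk_cols_def eq using fin by (intro sum.union_disjoint) auto
  then show ?thesis
    using fin by (simp add: sum.reindex sum.Sigma)
qed

lemma blk_row_eq:
  fixes V :: "nat \<Rightarrow> nat \<Rightarrow> 'a::field"
  assumes fin: "\<forall>i<l. finite (A i)" and "i < l" "r < m"
  shows "(\<Sum>c\<in>blk_cols l m A. blk_mat V (i, r) c * x c) =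
    x (Inl r) + (\<Sum>a\<in>A i. V r a * x (Inr (i, a)))"
proof -
  have "(\<Sum>i'<l. \<Sum>a\<in>A i'. blk_mat V (i, r) (Inr (i', a)) * x (Inr (i', a))) =
    (\<Sum>i'<l. if i' = i then \<Sum>a\<in>A i. V r a * x (Inr (i, a)) else 0)"
    by (rule sum.cong) (auto simp: blk_mat_def)
  moreover have "(\<Sum>r'<m. blk_mat V (i, r) (Inl r') * x (Inl r')) =
    (\<Sum>r'<m. if r' = r then x (Inl r) else 0)"
    by (rule sum.cong) (auto simp: blk_mat_def)
  ultimately show ?thesis using assms by (simp add: sum_blk_cols[OF fin])
qed

text \<open>The form in which kernels are used: \<open>y i\<close> is a vector supported on
  \<open>A i\<close>, and \<open>s\<close> is the negative of the syndrome that all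
  \<open>y i\<close> share.\<close>

lemma blk_full_rank_iff:
  fixes V :: "nat \<Rightarrow> nat \<Rightarrow> 'a::field"
  assumes fin: "\<forall>i<l. finite (A i)"
  shows "blk_full_rank l m A V \<longleftrightarrow>
    (\<forall>s y. (\<forall>i<l. \<forall>r<m. s r + (\<Sum>a\<in>A i. V r a * y i a) = 0) \<longrightarrow>
      (\<forall>r<m. s r = 0) \<and> (\<forall>i<l. \<forall>a\<in>A i. y i a = 0))" (is "?L \<longleftrightarrow> ?R")
proof
  assume L: ?L
  show ?R
  proof (intro allI impI)
    fix s :: "nat \<Rightarrow> 'a" and y :: "nat \<Rightarrow> nat \<Rightarrow> 'a"
    assume sy: "\<forall>i<l. \<forall>r<m. s r + (\<Sum>a\<in>A i. V r a * y i a) = 0"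
    let ?x = "case_sum s (\<lambda>(i, a). y i a)"
    have "\<forall>q\<in>blk_rows l m. (\<Sum>c\<in>blk_cols l m A. blk_mat V q c * ?x c) = 0"
      using sy by (auto simp: blk_rows_def blk_row_eq[OF fin])
    then have "\<forall>c\<in>blk_cols l m A. ?x c = 0"
      using L unfolding blk_full_rank_def full_col_rank_def by blast
    moreover have "Inl r \<in> blk_cols l m A" if "r < m" for r
      using that by (simp add: blk_cols_def)
    moreover have "Inr (i, a) \<in> blk_cols l m A" if "i < l" "a \<in> A i" for i a
      using that by (simp add: blk_cols_def)
    ultimately show "(\<forall>r<m. s r = 0) \<and> (\<forall>i<l. \<forall>a\<in>A i. y i a = 0)"
      by (metis (no_types, lifting) case_prod_conv sum.case)
  qed
next
  assume R: ?R
  show ?L unfolding blk_full_rank_def full_col_rank_def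
  proof (intro allI impI)
    fix x :: "nat + nat \<times> nat \<Rightarrow> 'a"
    assume x: "\<forall>q\<in>blk_rows l m. (\<Sum>c\<in>blk_cols l m A. blk_mat V q c * x c) = 0"
    have "\<forall>i<l. \<forall>r<m. x (Inl r) + (\<Sum>a\<in>A i. V r a * x (Inr (i, a))) = 0"
      using x by (auto simp: blk_rows_def blk_row_eq[OF fin])
    then have "(\<forall>r<m. x (Inl r) = 0) \<and> (\<forall>i<l. \<forall>a\<in>A i. x (Inr (i, a)) = 0)"
      using R[rule_format, of "\<lambda>r. x (Inl r)" "\<lambda>i a. x (Inr (i, a))"] by blast
    then show "\<forall>c\<in>blk_cols l m A. x c = 0" by (auto simp: blk_cols_def)
  qed
qed

lemma blk_full_rank_card_le:
  fixes V :: "nat \<Rightarrow> nat \<Rightarrow> 'a::field"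
  assumes fin: "\<forall>i<l. finite (A i)" and rank: "blk_full_rank l m A V"
  shows "m + (\<Sum>i<l. card (A i)) \<le> l * m"
proof (rule ccontr)
  assume "\<not> ?thesis"
  moreover have "blk_rows l m = {..<l} \<times> {..<m}" by (auto simp: blk_rows_def)
  moreover have "card (blk_cols l m A) = m + (\<Sum>i<l. card (A i))"
    using sum_blk_cols[OF fin, where g = "\<lambda>_. 1 :: nat"] by simp
  ultimately have "card (blk_rows l m) < card (blk_cols l m A)" "finite (blk_rows l m)"
    by simp_all
  then show False
    using underdetermined_system[OF _ finite_blk_cols[OF fin], of "blk_rows l m" m "blk_mat V"] rank
    unfolding blk_full_rank_def full_col_rank_def by blast
qed

text \<open>A kernel vector of the merged matrix lifts: every block of a fibre of \<open>f\<close>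
  receives a copy of the fibre's vector, whose support lies in all sets of the fibre. No fibre is
  empty, so every merged vector is seen.\<close>

lemma blk_full_rank_merge:
  fixes V :: "nat \<Rightarrow> nat \<Rightarrow> 'a::field"
  assumes fin: "\<forall>i<l. finite (A i)" and rank: "blk_full_rank l m A V"
    and f: "f ` {..<l} = {..<s}"
  shows "blk_full_rank s m (\<lambda>j. \<Inter>i\<in>{i. i < l \<and> f i = j}. A i) V"
proof -
  define B where "B j = (\<Inter>i\<in>{i. i < l \<and> f i = j}. A i)" for j
  have BA: "B (f i) \<subseteq> A i" if "i < l" for i using that by (auto simp: B_def)
  have finB: "\<forall>j<s. finite (B j)"
    using f BA fin by (metis (no_types, lifting) finite_subset imageE lessThan_iff)
  have "blk_full_rank s m B V"
    unfolding blk_full_rank_iff[OF finB]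
  proof (intro allI impI)
    fix x :: "nat \<Rightarrow> 'a" and y :: "nat \<Rightarrow> nat \<Rightarrow> 'a"
    assume xy: "\<forall>j<s. \<forall>r<m. x r + (\<Sum>a\<in>B j. V r a * y j a) = 0"
    define z where "z i a = (if a \<in> B (f i) then y (f i) a else 0)" for i a
    have "x r + (\<Sum>a\<in>A i. V r a * z i a) = 0" if "i < l" "r < m" for i r
    proof -
      have "(\<Sum>a\<in>A i. V r a * z i a) = (\<Sum>a\<in>B (f i). V r a * y (f i) a)"
        using BA[OF that(1)] fin[rule_format, OF that(1)]
        by (intro sum.mono_neutral_cong_right) (auto simp: z_def)
      moreover have "f i < s" using f that(1) by blast
      ultimately show ?thesis using xy that by simp
    qed
    then have *: "(\<forall>r<m. x r = 0) \<and> (\<forall>i<l. \<forall>a\<in>A i. z i a = 0)"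
      using rank[unfolded blk_full_rank_iff[OF fin]] by blast
    have "y j a = 0" if j: "j < s" and a: "a \<in> B j" for j a
    proof -
      obtain i where i: "i < l" "f i = j"
        using j f by (metis imageE lessThan_iff)
      then have "z i a = 0" using * a BA[OF i(1)] by blast
      then show ?thesis using a i(2) by (simp add: z_def)
    qed
    with * show "(\<forall>r<m. x r = 0) \<and> (\<forall>j<s. \<forall>a\<in>B j. y j a = 0)" by blast
  qed
  then show ?thesis unfolding B_def .
qed

text \<open>Brings shorter lists to the fixed number of blocks in the rank condition. The first
  \<open>l\<close> blocks already force \<open>x\<close> to vanish, so the vector of a repeated
  block, moved to block 0 with zeros elsewhere, is a kernel vector of the original matrix.\<close>

lemma blk_full_rank_pad:
  fixes V :: "nat \<Rightarrow> nat \<Rightarrow> 'a::field"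
  assumes fin: "\<forall>i<l. finite (A i)" and rank: "blk_full_rank l m A V"
    and "2 \<le> l" "l \<le> l'"
  shows "blk_full_rank l' m (\<lambda>i. A (if i < l then i else 0)) V"
proof -
  have fin': "\<forall>i<l'. finite (A (if i < l then i else 0))"
    using fin assms(3) by auto
  note R = rank[unfolded blk_full_rank_iff[OF fin], THEN spec, THEN spec, THEN mp]
  show ?thesis
    unfolding blk_full_rank_iff[OF fin']
  proof (intro allI impI)
    fix x :: "nat \<Rightarrow> 'a" and y :: "nat \<Rightarrow> nat \<Rightarrow> 'a"
    assume xy: "\<forall>i<l'. \<forall>r<m. x r + (\<Sum>a\<in>A (if i < l then i else 0). V r a * y i a) = 0"
    have "\<forall>i<l. \<forall>r<m. x r + (\<Sum>a\<in>A i. V r a * y i a) = 0"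
    proof (intro allI impI)
      fix i r assume "i < l" "r < m"
      then show "x r + (\<Sum>a\<in>A i. V r a * y i a) = 0"
        using xy[rule_format, of i r] \<open>l \<le> l'\<close> by simp
    qed
    then have *: "\<forall>r<m. x r = 0" "\<forall>i<l. \<forall>a\<in>A i. y i a = 0" using R[of x y] by simp_all
    have "y i a = 0" if i: "i < l'" "\<not> i < l" and a: "a \<in> A 0" for i a
    proof -
      have z: "\<forall>i'<l. \<forall>r<m. 0 + (\<Sum>a\<in>A i'. V r a * (if i' = 0 then y i a else 0)) = 0"
        
      proof (intro allI impI)
        fix i' r assume "i' < l" "r < m"
        then show "0 + (\<Sum>a\<in>A i'. V r a * (if i' = 0 then y i a else 0)) = 0"
          using xy[rule_format, OF i(1), of r] i(2) * by (cases "i' = 0") auto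
      qed
      have "0 < l" using assms(3) by simp
      then show ?thesis using R[OF z] a by fastforce
    qed
    with * show "(\<forall>r<m. x r = 0) \<and> (\<forall>i<l'. \<forall>a\<in>A (if i < l then i else 0). y i a = 0)"
      by auto
  qed
qed

section \<open>Rank of the generic block matrix\<close>

definition zeroed_generic :: "(nat \<times> nat) set \<Rightarrow> nat \<Rightarrow> nat \<Rightarrow> 'a::field ratfun" where
  "zeroed_generic S r a = (if (r, a) \<in> S then 0 else generic_mat r a)"

lemma generic_mat_neq_zero: "generic_mat r a \<noteq> (0 :: 'a::field ratfun)"
proof -
  have "Poly_Mapping.single (Poly_Mapping.single (r, a) (1::nat)) (1::'a) \<noteq> 0"
    by (metis lookup_single_eq lookup_zero zero_neq_one)
  then show ?thesis by (simp add: generic_mat_def Zero_fract_def eq_fract)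
qed

lemma full_col_rank_zeroed_generic_mono:
  assumes fin: "finite Cs" and "S \<subseteq> T"
    and rank: "full_col_rank R Cs (zeroed_generic T :: nat \<Rightarrow> nat \<Rightarrow> 'a::field ratfun)"
  shows "full_col_rank R Cs (zeroed_generic S :: nat \<Rightarrow> nat \<Rightarrow> 'a::field ratfun)"
proof -
  let ?m = "\<lambda>r a. Poly_Mapping.single (r, a) (1::nat)"
  let ?b = "\<lambda>r a. if (r, a) \<in> S then 0 else (1::'a)"
  have 1: "(zeroed_generic S :: nat \<Rightarrow> nat \<Rightarrow> 'a ratfun) = (\<lambda>r a. Fract (Poly_Mapping.single (?m r a) (?b r a)) 1)"
    by (intro ext) (simp add: zeroed_generic_def generic_mat_def Zero_fract_def)
  have 2: "(zeroed_generic T :: nat \<Rightarrow> nat \<Rightarrow> 'a ratfun) = (\<lambda>r a. Fract (Poly_Mapping.single (?m r a)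
      (if sdeg T (?m r a) = 0 then ?b r a else 0)) 1)"
    using \<open>S \<subseteq> T\<close> by (intro ext) (auto simp: zeroed_generic_def generic_mat_def Zero_fract_def sdeg_single)
  show ?thesis
    unfolding 1 using rank[unfolded 2]
    by (rule full_col_rank_specialise[OF fin, where m = ?m and b = ?b])
qed

lemma blk_full_rank_generic_if_zeroed:
  assumes fin: "\<forall>i<l. finite (A i)"
    and rank: "blk_full_rank l m A (zeroed_generic S :: nat \<Rightarrow> nat \<Rightarrow> 'a::field ratfun)"
  shows "blk_full_rank l m A (generic_mat :: nat \<Rightarrow> nat \<Rightarrow> 'a ratfun)"
proof -
  \<comment> \<open>Every entry is written as a coefficient times a monomial; entries of the
    identity blocks get the trivial monomial, which no specialisation touches.\<close>
  let ?m = "\<lambda>(i::nat, r) c. case c of Inl (_::nat) \<Rightarrow> 0 | Inr (_::nat, a) \<Rightarrow> Poly_Mapping.single (r::nat, a::nat) (1::nat)"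
  let ?b = "\<lambda>(i, r) c. case c of Inl r' \<Rightarrow> if r = r' then 1 else 0 | Inr (i', _) \<Rightarrow> if i = i' then 1 else (0::'a)"
  have 1: "(blk_mat generic_mat :: _ \<Rightarrow> _ \<Rightarrow> 'a ratfun) = (\<lambda>q c. Fract (Poly_Mapping.single (?m q c) (?b q c)) 1)"
    by (intro ext) (auto simp: blk_mat_def generic_mat_def Zero_fract_def One_fract_def
        split: sum.splits prod.splits)
  have 2: "(blk_mat (zeroed_generic S) :: _ \<Rightarrow> _ \<Rightarrow> 'a ratfun) = (\<lambda>q c. Fract (Poly_Mapping.single (?m q c)
      (if sdeg S (?m q c) = 0 then ?b q c else 0)) 1)"
    by (intro ext) (auto simp: blk_mat_def zeroed_generic_def generic_mat_def Zero_fract_def One_fract_def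
        sdeg_single split: sum.splits prod.splits)
  show ?thesis
    unfolding blk_full_rank_def 1 using rank[unfolded blk_full_rank_def 2]
    by (rule full_col_rank_specialise[OF finite_blk_cols[OF fin], where m = ?m and b = ?b])
qed

text \<open>Row \<open>r\<close> is reserved for block \<open>t r\<close>: zeroing its entries in the columns \<open>A (t r)\<close> makes the
  common syndrome vanish at \<open>r\<close>.\<close>

lemma blk_full_rank_generic:
  assumes fin: "\<forall>i<l. finite (A i)"
    and t: "\<And>r. r < m \<Longrightarrow> t r < l"
    and card: "\<And>P. P \<subseteq> {..<l} \<Longrightarrow> P \<noteq> {} \<Longrightarrow> card (\<Inter>i\<in>P. A i) + card {r. r < m \<and> t r \<in> P} \<le> m"
  shows "blk_full_rank l m A (generic_mat :: nat \<Rightarrow> nat \<Rightarrow> 'a::field ratfun)"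
proof (rule blk_full_rank_generic_if_zeroed[OF fin])
  define S where "S = {(r, a). r < m \<and> a \<in> A (t r)}"
  let ?W = "zeroed_generic S :: nat \<Rightarrow> nat \<Rightarrow> 'a ratfun"
  have cols: "full_col_rank {..<m} (A i) ?W" if i: "i < l" for i
  proof -
    \<comment> \<open>The rows in which column \<open>a\<close> survives. A matching into them
      selects surviving entries in distinct rows.\<close>
    let ?N = "\<lambda>a. {r. r < m \<and> a \<notin> A (t r)}"
    have "card B \<le> card (\<Union>a\<in>B. ?N a)" if B: "B \<subseteq> A i" for B
    proof -
      \<comment> \<open>The rows outside every \<open>?N a\<close> with \<open>a \<in> B\<close> are
        those reserved for a block whose set contains \<open>B\<close>. Hence the bound
        \<open>card\<close> for these blocks is Hall's condition for \<open>B\<close>.\<close>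
      let ?P = "{j. j < l \<and> B \<subseteq> A j}" and ?Q = "{r. r < m \<and> B \<subseteq> A (t r)}"
      have "card B \<le> card (\<Inter>j\<in>?P. A j)"
        by (rule card_mono) (use i B fin in \<open>auto intro: finite_subset[of _ "A i"]\<close>)
      moreover have "{r. r < m \<and> t r \<in> ?P} = ?Q" using t by auto
      ultimately have "card B + card ?Q \<le> m" using card[of ?P] i B by force
      moreover have "card (\<Union>a\<in>B. ?N a) + card ?Q = card ((\<Union>a\<in>B. ?N a) \<union> ?Q)"
        by (rule card_Un_disjoint[symmetric]) (auto intro: finite_subset[of _ "{..<m}"])
      moreover have "(\<Union>a\<in>B. ?N a) \<union> ?Q = {..<m}" by auto
      ultimately show ?thesis by simp
    qed
    then have "\<exists>\<sigma>. inj_on \<sigma> (A i) \<and> (\<forall>a\<in>A i. \<sigma> a \<in> ?N a)"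
      using fin[rule_format, OF i] by (intro hall_marriage) auto
    then obtain \<sigma> where \<sigma>: "inj_on \<sigma> (A i)" "\<And>a. a \<in> A i \<Longrightarrow> \<sigma> a < m \<and> a \<notin> A (t (\<sigma> a))"
      by blast
    \<comment> \<open>With all unmatched entries zeroed as well, row \<open>\<sigma> a\<close> has
      its only nonzero entry in column \<open>a\<close>.\<close>
    define T where "T = {(r, a). r \<noteq> \<sigma> a \<or> a \<notin> A i}"
    have "full_col_rank {..<m} (A i) (zeroed_generic (S \<union> T) :: nat \<Rightarrow> nat \<Rightarrow> 'a ratfun)"
      unfolding full_col_rank_def
    proof (intro allI impI ballI)
      fix x :: "nat \<Rightarrow> 'a ratfun" and a
      assume x: "\<forall>r\<in>{..<m}. (\<Sum>c\<in>A i. zeroed_generic (S \<union> T) r c * x c) = 0" and a: "a \<in> A i"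
      have "0 = (\<Sum>c\<in>A i. zeroed_generic (S \<union> T) (\<sigma> a) c * x c)" using x \<sigma>(2)[OF a] by simp
      also have "\<dots> = (\<Sum>c\<in>A i. if c = a then generic_mat (\<sigma> a) a * x a else 0)"
        using \<sigma> a by (intro sum.cong) (auto simp: zeroed_generic_def S_def T_def inj_on_def)
      finally show "x a = 0" using a fin[rule_format, OF i] generic_mat_neq_zero[where 'a = 'a] by simp
    qed
    then show ?thesis by (rule full_col_rank_zeroed_generic_mono[OF fin[rule_format, OF i], rotated]) simp
  qed
  show "blk_full_rank l m A ?W"
    unfolding blk_full_rank_iff[OF fin]
  proof (intro allI impI)
    fix x :: "nat \<Rightarrow> 'a ratfun" and y :: "nat \<Rightarrow> nat \<Rightarrow> 'a ratfun"
    assume xy: "\<forall>i<l. \<forall>r<m. x r + (\<Sum>a\<in>A i. ?W r a * y i a) = 0"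
    have x: "x r = 0" if "r < m" for r
    proof -
      have "(\<Sum>a\<in>A (t r). ?W r a * y (t r) a) = 0"
        using that by (intro sum.neutral) (auto simp: zeroed_generic_def S_def)
      then show ?thesis using xy[rule_format, OF t[OF that] that] by simp
    qed
    have "\<forall>a\<in>A i. y i a = 0" if i: "i < l" for i
      using cols[OF i, unfolded full_col_rank_def, THEN spec[of _ "y i"]] xy x i by simp
    with x show "(\<forall>r<m. x r = 0) \<and> (\<forall>i<l. \<forall>a\<in>A i. y i a = 0)" by blast
  qed
qed

text \<open>Each \<open>i\<close> offers \<open>\<delta> i\<close> slots; the \<open>m\<close> rows
  are placed injectively into slots, and \<open>t\<close> reads off the owner of the slot.\<close>

lemma exists_map_bounded_fibres:
  fixes \<delta> :: "nat \<Rightarrow> nat"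
  assumes "m \<le> (\<Sum>i<l. \<delta> i)"
  shows "\<exists>t. (\<forall>r<m. t r < l) \<and> (\<forall>P\<subseteq>{..<l}. card {r. r < m \<and> t r \<in> P} \<le> sum \<delta> P)"
proof -
  let ?D = "SIGMA i:{..<l}. {..<\<delta> i}"
  have "card {..<m} \<le> card ?D" using assms by simp
  then obtain h where h: "inj_on h {..<m}" "h ` {..<m} \<subseteq> ?D"
    by (meson card_le_inj finite_SigmaI finite_lessThan)
  have "card {r. r < m \<and> fst (h r) \<in> P} \<le> sum \<delta> P" if P: "P \<subseteq> {..<l}" for P
  proof -
    have finP: "finite P" using P finite_subset by blast
    have "card {r. r < m \<and> fst (h r) \<in> P} \<le> card (SIGMA i:P. {..<\<delta> i})"
      by (rule card_inj_on_le[of h]) (use h finP in \<open>force simp: inj_on_def\<close>)+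
    then show ?thesis using finP by simp
  qed
  moreover have "\<forall>r<m. fst (h r) < l" using h by force
  ultimately show ?thesis by (intro exI[of _ "fst \<circ> h"]) simp
qed

text \<open>Block \<open>i\<close> offers \<open>m - card (A i)\<close> slots. Then
  \<open>total\<close> provides slots for all \<open>m\<close> rows, and \<open>proper\<close> says
  that the slots of \<open>P\<close> and the intersection of its sets together number at most
  \<open>m\<close>.\<close>

lemma blk_full_rank_generic_of_card_sums:
  assumes fin: "\<And>i. i \<le> l \<Longrightarrow> finite (A i)"
    and total: "(\<Sum>i\<le>l. card (A i)) \<le> l * m"
    and proper: "\<And>P. P \<subset> {..l} \<Longrightarrow> P \<noteq> {} \<Longrightarrow>
      (card P - 1) * m + card (\<Inter>i\<in>P. A i) \<le> (\<Sum>i\<in>P. card (A i))"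
    and inter: "(\<Inter>i\<le>l. A i) = {}" and "1 \<le> l"
  shows "blk_full_rank (Suc l) m A (generic_mat :: nat \<Rightarrow> nat \<Rightarrow> 'a::field ratfun)"
proof -
  \<comment> \<open>Comparing \<open>proper\<close> for all blocks but \<open>i\<close> with
    \<open>total\<close>. This makes the truncated subtraction in \<open>\<delta>\<close>
    exact.\<close>
  have le: "card (A i) \<le> m" if "i \<le> l" for i
  proof -
    have cP: "card ({..l} - {i}) = l" using that by simp
    have "(l - 1) * m \<le> (\<Sum>i\<in>{..l} - {i}. card (A i))"
      using proper[of "{..l} - {i}"] that cP \<open>1 \<le> l\<close> by (metis Diff_subset add_leD1 card.empty
          card_atMost n_not_Suc_n not_one_le_zero psubsetI)
    moreover have "(\<Sum>i\<le>l. card (A i)) = card (A i) + (\<Sum>i\<in>{..l} - {i}. card (A i))"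
      using that by (simp add: sum.remove)
    moreover have "l * m = m + (l - 1) * m" using \<open>1 \<le> l\<close> by (cases l) auto
    ultimately show ?thesis using total by linarith
  qed
  define \<delta> where "\<delta> i = m - card (A i)" for i
  have sum_\<delta>: "sum \<delta> P + (\<Sum>i\<in>P. card (A i)) = card P * m" if "P \<subseteq> {..l}" for P
  proof -
    have "sum \<delta> P + (\<Sum>i\<in>P. card (A i)) = (\<Sum>i\<in>P. \<delta> i + card (A i))" by (simp add: sum.distrib)
    also have "\<dots> = (\<Sum>i\<in>P. m)" using that le by (intro sum.cong) (auto simp: \<delta>_def)
    finally show ?thesis by simp
  qed
  have "m \<le> (\<Sum>i<Suc l. \<delta> i)"
    using sum_\<delta>[of "{..l}"] total by (simp add: lessThan_Suc_atMost)
  then obtain t where t: "\<forall>r<m. t r < Suc l"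
    "\<forall>P\<subseteq>{..<Suc l}. card {r. r < m \<and> t r \<in> P} \<le> sum \<delta> P"
    using exists_map_bounded_fibres by blast
  show ?thesis
  proof (rule blk_full_rank_generic[of _ _ _ t])
    fix P assume P: "P \<subseteq> {..<Suc l}" "P \<noteq> {}"
    show "card (\<Inter>i\<in>P. A i) + card {r. r < m \<and> t r \<in> P} \<le> m"
    proof (cases "P = {..l}")
      case True
      \<comment> \<open>For the full set the slots may outnumber \<open>m\<close>, but there are
        only \<open>m\<close> rows and the intersection is empty.\<close>
      have "card {r. r < m \<and> t r \<in> P} \<le> card {..<m}" by (rule card_mono) auto
      then show ?thesis using True inter by simp
    next
      case False
      then have "P \<subset> {..l}" using P by auto
      moreover have "card P * m = m + (card P - 1) * m"
        using P finite_subset[OF P(1)] by (cases "card P") auto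
      moreover have "card {r. r < m \<and> t r \<in> P} \<le> sum \<delta> P" using t(2) P by blast
      ultimately show ?thesis
        using proper[of P] P(2) sum_\<delta>[of P] by (simp add: psubset_imp_subset)
    qed
  qed (use fin t in auto)
qed

section \<open>Dual codes\<close>

lemma gen_matrix_memI:
  "gen_matrix n k G C \<Longrightarrow> (\<lambda>j. if j < n then \<Sum>r<k. u r * G r j else 0) \<in> C"
  by (auto simp: gen_matrix_def)

lemma gen_matrix_memE:
  assumes "gen_matrix n k G C" and "c \<in> C"
  obtains u where "c = (\<lambda>j. if j < n then \<Sum>r<k. u r * G r j else 0)"
  using assms by (auto simp: gen_matrix_def)

lemma code_subset_vecs: "gen_matrix n k G C \<Longrightarrow> C \<subseteq> vecs n"
  by (auto simp: gen_matrix_def vecs_def)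

lemma code_add_smult:
  fixes C :: "(nat \<Rightarrow> 'a::field) set"
  assumes G: "gen_matrix n k G C" and "c \<in> C" "c' \<in> C"
  shows "(\<lambda>j. c j + a * c' j) \<in> C"
proof -
  obtain u where u: "c = (\<lambda>j. if j < n then \<Sum>r<k. u r * G r j else 0)"
    using gen_matrix_memE[OF G \<open>c \<in> C\<close>] .
  obtain u' where u': "c' = (\<lambda>j. if j < n then \<Sum>r<k. u' r * G r j else 0)"
    using gen_matrix_memE[OF G \<open>c' \<in> C\<close>] .
  have "(\<lambda>j. c j + a * c' j) = (\<lambda>j. if j < n then \<Sum>r<k. (u r + a * u' r) * G r j else 0)"
    by (auto simp: u u' sum.distrib sum_distrib_left algebra_simps)
  then show ?thesis using gen_matrix_memI[OF G, of "\<lambda>r. u r + a * u' r"] by simp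
qed

lemma code_lincomb:
  fixes C :: "(nat \<Rightarrow> 'a::field) set"
  assumes G: "gen_matrix n k G C" and "finite J" and "\<And>j. j \<in> J \<Longrightarrow> g j \<in> C"
  shows "(\<lambda>t. \<Sum>j\<in>J. x j * g j t) \<in> C"
  using assms(2,3)
proof (induction J rule: finite_induct)
  case empty
  show ?case using gen_matrix_memI[OF G, of "\<lambda>_. 0"] by (simp cong: if_cong)
next
  case (insert j J)
  then show ?case
    using code_add_smult[OF G, of "\<lambda>t. \<Sum>j\<in>J. x j * g j t" "g j" "x j"] by (simp add: add.commute)
qed

text \<open>Takes the place of row reduction to a systematic generator matrix: the
  \<open>g j\<close> are its rows, \<open>J\<close> the positions of its identity block.\<close>

lemma code_information_set:
  fixes C :: "(nat \<Rightarrow> 'a::field) set"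
  assumes G: "gen_matrix n k G C"
  shows "\<exists>J g. J \<subseteq> {..<n} \<and> card J = k \<and> (\<forall>j\<in>J. g j \<in> C) \<and>
    (\<forall>i\<in>J. \<forall>j\<in>J. g i j = (if j = i then 1 else 0)) \<and>
    (\<forall>c\<in>C. \<forall>t. c t = (\<Sum>j\<in>J. c j * g j t))"
proof -
  \<comment> \<open>A maximal set of positions on which codewords take arbitrary values determines each codeword.\<close>
  let ?F = "{J. J \<subseteq> {..<n} \<and> (\<forall>v. \<exists>c\<in>C. \<forall>j\<in>J. c j = v j)}"
  have "finite ?F" by (rule finite_subset[of _ "Pow {..<n}"]) auto
  moreover have "{} \<in> ?F" using gen_matrix_memI[OF G] by auto
  ultimately have "\<exists>J\<in>?F. \<forall>K\<in>?F. J \<subseteq> K \<longrightarrow> J = K"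
    by (intro finite_has_maximal) auto
  then obtain J where J: "J \<in> ?F" and max: "\<And>K. K \<in> ?F \<Longrightarrow> J \<subseteq> K \<Longrightarrow> J = K"
    by (elim bexE) (simp only: Ball_def)
  have finJ: "finite J" using J finite_subset[of J "{..<n}"] by simp
  \<comment> \<open>Otherwise a multiple of \<open>c\<close> adjusts the value at \<open>t\<close>
    without disturbing \<open>J\<close>, and \<open>insert t J\<close> contradicts
    maximality.\<close>
  have det0: "c t = 0" if c: "c \<in> C" "\<forall>j\<in>J. c j = 0" for c t
  proof (rule ccontr)
    assume t: "c t \<noteq> 0"
    have "t < n" using c(1) t code_subset_vecs[OF G] by (force simp: vecs_def not_le[symmetric])
    have "\<exists>d\<in>C. \<forall>j\<in>insert t J. d j = v j" for v
    proof -
      obtain d where d: "d \<in> C" "\<forall>j\<in>J. d j = v j" using J by blast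
      then have "(\<lambda>j. d j + (v t - d t) / c t * c j) \<in> C" using code_add_smult[OF G] c by blast
      then show ?thesis using t c(2) d(2)
        by (intro bexI[of _ "\<lambda>j. d j + (v t - d t) / c t * c j"]) auto
    qed
    then have "insert t J \<in> ?F" using J \<open>t < n\<close> by simp
    then have "t \<in> J" using max by blast
    then show False using c(2) t by simp
  qed
  have sur: "\<exists>c\<in>C. \<forall>j\<in>J. c j = v j" for v using J by simp
  have "\<forall>i. \<exists>c\<in>C. \<forall>j\<in>J. c j = (if j = i then 1 else 0)"
    using sur[of "\<lambda>j. if j = _ then 1 else 0"] by blast
  then obtain g where g: "\<And>i. g i \<in> C" "\<And>i j. j \<in> J \<Longrightarrow> g i j = (if j = i then 1 else 0)"
    by metis
  have unit: "(\<Sum>j\<in>J. x j * g j t) = x t" if "t \<in> J" for x t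
  proof -
    have "(\<Sum>j\<in>J. x j * g j t) = (\<Sum>j\<in>J. if j = t then x t else 0)"
      using g that by (intro sum.cong) auto
    then show ?thesis using finJ that by simp
  qed
  have exp: "c t = (\<Sum>j\<in>J. c j * g j t)" if c: "c \<in> C" for c t
  proof -
    have "(\<lambda>t. c t + (- 1) * (\<Sum>j\<in>J. c j * g j t)) \<in> C"
      using code_add_smult[OF G c code_lincomb[OF G finJ]] g by blast
    from det0[OF this, of t] show ?thesis by (simp add: unit)
  qed
  have indep: "\<forall>r<k. u r = 0" if "\<forall>j<n. (\<Sum>r<k. u r * G r j) = 0" for u
    using G that unfolding gen_matrix_def by blast
  \<comment> \<open>A nonzero message would encode to a word that is zero on \<open>J\<close>, hence
    zero by \<open>det0\<close>, against the independence of the rows of \<open>G\<close>.\<close>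
  have "\<not> card J < k"
  proof
    assume "card J < k"
    then obtain u where u: "\<forall>j\<in>J. (\<Sum>r<k. G r j * u r) = 0" "\<exists>r\<in>{..<k}. u r \<noteq> 0"
      using underdetermined_system[OF finJ, of "{..<k}" "\<lambda>j r. G r j"] by auto
    let ?c = "\<lambda>j. if j < n then \<Sum>r<k. u r * G r j else 0"
    have "\<forall>j\<in>J. ?c j = 0" using u(1) by (simp add: mult.commute)
    then have "?c t = 0" for t using det0 gen_matrix_memI[OF G] by blast
    then have "\<forall>j<n. (\<Sum>r<k. u r * G r j) = 0" by (metis (no_types, lifting))
    then show False using indep u(2) by blast
  qed
  \<comment> \<open>More than \<open>k\<close> coefficient vectors are dependent, yet the
    combination of the \<open>g j\<close> with coefficients \<open>x\<close> takes the value
    \<open>x t\<close> at \<open>t\<close>.\<close>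
  moreover have "\<not> k < card J"
  proof
    assume k: "k < card J"
    have "\<exists>u. g j = (\<lambda>t. if t < n then \<Sum>r<k. u r * G r t else 0)" for j
      by (rule gen_matrix_memE[OF G g(1)[of j]]) (rule exI)
    then obtain U where U: "\<And>j. g j = (\<lambda>t. if t < n then \<Sum>r<k. U j r * G r t else 0)" by metis
    obtain x where x: "\<forall>r\<in>{..<k}. (\<Sum>j\<in>J. U j r * x j) = 0" "\<exists>j\<in>J. x j \<noteq> 0"
      using underdetermined_system[OF _ finJ, of "{..<k}" "\<lambda>r j. U j r"] k by auto
    have "x t = 0" if t: "t \<in> J" for t
    proof -
      have "t < n" using t J by blast
      have "x t = (\<Sum>j\<in>J. x j * (\<Sum>r<k. U j r * G r t))"
        using unit[OF t, of x] \<open>t < n\<close> by (simp add: U)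
      also have "\<dots> = (\<Sum>r<k. (\<Sum>j\<in>J. U j r * x j) * G r t)"
        by (simp add: sum_distrib_left sum_distrib_right mult_ac sum.swap[of _ J])
      also have "\<dots> = 0" using x(1) by simp
      finally show ?thesis .
    qed
    then show False using x(2) by blast
  qed
  ultimately have "card J = k" by simp
  then show ?thesis using J g exp by (intro exI[of _ J] exI[of _ g]) auto
qed

lemma dual_code_smult_sum:
  fixes C :: "(nat \<Rightarrow> 'a::field) set"
  assumes "\<And>r. r \<in> R \<Longrightarrow> h r \<in> dual_code n C"
  shows "(\<lambda>j. \<Sum>r\<in>R. u r * h r j) \<in> dual_code n C"
proof -
  have "(\<Sum>j<n. c j * (\<Sum>r\<in>R. u r * h r j)) = 0" if "c \<in> C" for c
  proof -
    have "(\<Sum>j<n. c j * (\<Sum>r\<in>R. u r * h r j)) = (\<Sum>r\<in>R. u r * (\<Sum>j<n. c j * h r j))"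
      by (simp add: sum_distrib_left mult_ac sum.swap[of _ R])
    also have "\<dots> = 0" using assms that by (intro sum.neutral) (auto simp: dual_code_def)
    finally show ?thesis .
  qed
  then show ?thesis using assms by (auto simp: dual_code_def vecs_def intro!: sum.neutral)
qed

text \<open>If \<open>J\<close> is an information set with unit codewords \<open>g\<close>, these vectors for \<open>t \<notin> J\<close> form a basis
  of the dual code.\<close>

definition check_vec :: "nat set \<Rightarrow> (nat \<Rightarrow> nat \<Rightarrow> 'a::field) \<Rightarrow> nat \<Rightarrow> nat \<Rightarrow> 'a" where
  "check_vec J g t a = (if a \<in> J then - g a t else if a = t then 1 else 0)"

text \<open>Orthogonality to the check vector at \<open>t\<close> thus says that \<open>y t\<close>
  is the value predicted from \<open>y\<close> on \<open>J\<close> by the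
  \<open>g a\<close>.\<close>

lemma sum_check_vec:
  fixes y :: "nat \<Rightarrow> 'a::field"
  assumes "J \<subseteq> {..<n}" "t < n" "t \<notin> J"
  shows "(\<Sum>a<n. y a * check_vec J g t a) = y t - (\<Sum>a\<in>J. y a * g a t)"
proof -
  have "(\<Sum>a<n. y a * check_vec J g t a) =
      (\<Sum>a\<in>{..<n} - J. y a * check_vec J g t a) + (\<Sum>a\<in>J. y a * check_vec J g t a)"
    using assms by (simp add: sum.subset_diff)
  also have "(\<Sum>a\<in>{..<n} - J. y a * check_vec J g t a) = (\<Sum>a\<in>{..<n} - J. if a = t then y t else 0)"
    by (rule sum.cong) (auto simp: check_vec_def)
  also have "\<dots> = y t" using assms by simp
  also have "(\<Sum>a\<in>J. y a * check_vec J g t a) = - (\<Sum>a\<in>J. y a * g a t)"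
    by (simp add: check_vec_def sum_negf)
  finally show ?thesis by simp
qed

text \<open>Outside \<open>J\<close> the check vectors are unit vectors, hence independent. They
  span because a dual word is determined by its values outside \<open>J\<close>: pairing it with
  \<open>g a\<close> recovers its value at \<open>a \<in> J\<close>.\<close>

lemma dual_code_gen_matrix:
  fixes C :: "(nat \<Rightarrow> 'a::field) set"
  assumes G: "gen_matrix n k G C"
  shows "k \<le> n" and "\<exists>H. gen_matrix n (n - k) H (dual_code n C)"
proof -
  obtain J g where J: "J \<subseteq> {..<n}" "card J = k" and gC': "\<forall>j\<in>J. g j \<in> C"
    and unit: "\<forall>i\<in>J. \<forall>j\<in>J. g i j = (if j = i then 1 else 0)"
    and exp': "\<forall>c\<in>C. \<forall>t. c t = (\<Sum>j\<in>J. c j * g j t)"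
    using code_information_set[OF G] by (elim exE conjE)
  note gC = gC'[rule_format] and exp = exp'[rule_format]
  have finJ: "finite J" using J finite_subset by blast
  show "k \<le> n" using J card_mono[of "{..<n}" J] by simp
  let ?T = "{..<n} - J" and ?h = "check_vec J g"
  have cardT: "card ?T = n - k" using J finJ by (simp add: card_Diff_subset)
  obtain e where e: "bij_betw e {..<n - k} ?T"
    using ex_bij_betw_nat_finite[of ?T] cardT by (auto simp: atLeast0LessThan)
  have hdual: "?h t \<in> dual_code n C" if "t \<in> ?T" for t
  proof -
    have "(\<Sum>a<n. c a * ?h t a) = 0" if "c \<in> C" for c
      using sum_check_vec[OF J(1), of t c g] exp[OF that, of t] \<open>t \<in> ?T\<close> by simp
    moreover have "?h t \<in> vecs n" using that J by (auto simp: vecs_def check_vec_def)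
    ultimately show ?thesis by (simp add: dual_code_def)
  qed
  have hunit: "(\<Sum>t\<in>?T. x t * ?h t a) = x a" if "a \<in> ?T" for x a
  proof -
    have "(\<Sum>t\<in>?T. x t * ?h t a) = (\<Sum>t\<in>?T. if t = a then x a else 0)"
      using that by (intro sum.cong) (auto simp: check_vec_def)
    then show ?thesis using that by simp
  qed
  have hexp: "y = (\<lambda>a. if a < n then \<Sum>t\<in>?T. y t * ?h t a else 0)" if y: "y \<in> dual_code n C" for y
  proof
    fix a
    consider "n \<le> a" | "a \<in> ?T" | "a \<in> J" "a < n" using J by (meson DiffI lessThan_iff not_le)
    then show "y a = (if a < n then \<Sum>t\<in>?T. y t * ?h t a else 0)"
    proof cases
      case 1
      then show ?thesis using y by (simp add: dual_code_def vecs_def)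
    next
      case 2
      then show ?thesis using hunit[of a y] by simp
    next
      case 3
      have "0 = (\<Sum>b<n. g a b * y b)" using gC[OF 3(1)] y by (simp add: dual_code_def)
      also have "\<dots> = (\<Sum>b\<in>?T. g a b * y b) + (\<Sum>b\<in>J. g a b * y b)"
        using J by (simp add: sum.subset_diff)
      also have "(\<Sum>b\<in>J. g a b * y b) = (\<Sum>b\<in>J. if b = a then y a else 0)"
        using 3 unit by (intro sum.cong) auto
      also have "\<dots> = y a" using 3 finJ by simp
      also have "(\<Sum>b\<in>?T. g a b * y b) = - (\<Sum>t\<in>?T. y t * ?h t a)"
        using 3 by (simp add: check_vec_def sum_negf mult.commute)
      finally show ?thesis using 3 by simp
    qed
  qed
  have reindex: "(\<Sum>r<n - k. u (e r) * ?h (e r) j) = (\<Sum>t\<in>?T. u t * ?h t j)" for u j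
    using sum.reindex_bij_betw[OF e, of "\<lambda>t. u t * ?h t j"] .
  have inv_e: "inv_into {..<n - k} e (e r) = r" if "r < n - k" for r
    using that e by (simp add: bij_betw_inv_into_left)
  have reindex': "(\<Sum>r<n - k. u r * ?h (e r) j) = (\<Sum>t\<in>?T. u (inv_into {..<n - k} e t) * ?h t j)" for u j
    using reindex[of "\<lambda>t. u (inv_into {..<n - k} e t)" j] inv_e by simp
  have eT: "e r \<in> ?T" if "r < n - k" for r
    using e that by (meson bij_betwE lessThan_iff)
  have "gen_matrix n (n - k) (\<lambda>r. ?h (e r)) (dual_code n C)"
    unfolding gen_matrix_def
  proof (intro conjI allI impI)
    fix u r assume u: "\<forall>j<n. (\<Sum>r<n - k. u r * ?h (e r) j) = 0" and r: "r < n - k"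
    have "(\<Sum>t\<in>?T. u (inv_into {..<n - k} e t) * ?h t (e r)) = 0"
      using u eT[OF r] by (simp add: reindex')
    then show "u r = 0" using hunit[OF eT[OF r]] inv_e[OF r] by simp
  next
    show "dual_code n C = {(\<lambda>j. if j < n then \<Sum>r<n - k. u r * ?h (e r) j else 0) | u. True}"
    proof (intro equalityI subsetI)
      fix y assume y: "y \<in> dual_code n C"
      then have "y = (\<lambda>a. if a < n then \<Sum>r<n - k. y (e r) * ?h (e r) a else 0)"
        unfolding reindex by (intro hexp)
      then show "y \<in> {(\<lambda>j. if j < n then \<Sum>r<n - k. u r * ?h (e r) j else 0) | u. True}"
        by (intro CollectI exI[of _ "\<lambda>r. y (e r)"]) simp
    next
      fix y assume "y \<in> {(\<lambda>j. if j < n then \<Sum>r<n - k. u r * ?h (e r) j else 0) | u. True}"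
      then obtain u where y: "y = (\<lambda>j. if j < n then \<Sum>r<n - k. u r * ?h (e r) j else 0)" by blast
      have mem: "(\<lambda>j. \<Sum>r<n - k. u r * ?h (e r) j) \<in> dual_code n C"
        using hdual eT by (intro dual_code_smult_sum) auto
      then have "\<forall>j\<ge>n. (\<Sum>r<n - k. u r * ?h (e r) j) = 0" by (simp add: dual_code_def vecs_def)
      then have "y = (\<lambda>j. \<Sum>r<n - k. u r * ?h (e r) j)" unfolding y by (auto simp: not_less)
      then show "y \<in> dual_code n C" using mem by simp
    qed
  qed
  then show "\<exists>H. gen_matrix n (n - k) H (dual_code n C)" by blast
qed

text \<open>The inclusion of the double dual in \<open>C\<close>. Orthogonality to the check vectors
  makes \<open>y\<close> the combination of the \<open>g j\<close> that agrees with it on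
  \<open>J\<close>.\<close>

lemma code_mem_if_parity_checks:
  fixes C :: "(nat \<Rightarrow> 'a::field) set"
  assumes G: "gen_matrix n k G C" and H: "gen_matrix n k' H (dual_code n C)"
    and y: "y \<in> vecs n" and checks: "\<forall>r<k'. (\<Sum>j<n. H r j * y j) = 0"
  shows "y \<in> C"
proof -
  obtain J g where J: "J \<subseteq> {..<n}" "card J = k" and gC': "\<forall>j\<in>J. g j \<in> C"
    and unit: "\<forall>i\<in>J. \<forall>j\<in>J. g i j = (if j = i then 1 else 0)"
    and exp': "\<forall>c\<in>C. \<forall>t. c t = (\<Sum>j\<in>J. c j * g j t)"
    using code_information_set[OF G] by (elim exE conjE)
  note gC = gC'[rule_format] and exp = exp'[rule_format]
  have finJ: "finite J" using J finite_subset by blast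
  have orth: "(\<Sum>j<n. y j * z j) = 0" if z: "z \<in> dual_code n C" for z
  proof -
    obtain u where u: "z = (\<lambda>j. if j < n then \<Sum>r<k'. u r * H r j else 0)"
      using gen_matrix_memE[OF H z] .
    have "(\<Sum>j<n. y j * z j) = (\<Sum>j<n. y j * (\<Sum>r<k'. u r * H r j))" by (simp add: u)
    also have "\<dots> = (\<Sum>r<k'. u r * (\<Sum>j<n. H r j * y j))"
      by (simp add: sum_distrib_left mult_ac sum.swap[of _ "{..<k'}"])
    finally show ?thesis using checks by simp
  qed
  have "y t = (\<Sum>j\<in>J. y j * g j t)" for t
  proof -
    consider "n \<le> t" | "t \<in> J" | "t < n" "t \<notin> J" by linarith
    then show ?thesis
    proof cases
      case 1
      then have "\<forall>j\<in>J. g j t = 0" using gC code_subset_vecs[OF G] by (auto simp: vecs_def)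
      then show ?thesis using 1 y by (simp add: vecs_def)
    next
      case 2
      have "(\<Sum>j\<in>J. y j * g j t) = (\<Sum>j\<in>J. if j = t then y t else 0)"
        using 2 unit by (intro sum.cong) auto
      then show ?thesis using 2 finJ by simp
    next
      case 3
      have "check_vec J g t \<in> dual_code n C"
        using sum_check_vec[OF J(1) 3, where g = g] exp J 3
        by (auto simp: dual_code_def vecs_def check_vec_def)
      then show ?thesis using orth sum_check_vec[OF J(1) 3, of y g] by simp
    qed
  qed
  then have "y = (\<lambda>t. \<Sum>j\<in>J. y j * g j t)" by blast
  also have "\<dots> \<in> C" using gC by (intro code_lincomb[OF G finJ])
  finally show ?thesis .
qed

lemma dual_gen_matrix_orthogonal:
  assumes H: "gen_matrix n k' H (dual_code n C)" and "c \<in> C" "r < k'"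
  shows "(\<Sum>j<n. H r j * c j) = 0"
proof -
  \<comment> \<open>Row \<open>r\<close> of \<open>H\<close> is the dual codeword of the
    \<open>r\<close>-th unit message.\<close>
  have "(\<lambda>j. if j < n then \<Sum>i<k'. (if i = r then 1 else 0) * H i j else 0) \<in> dual_code n C"
    using gen_matrix_memI[OF H] .
  then have "(\<Sum>j<n. c j * (\<Sum>i<k'. (if i = r then 1 else 0) * H i j)) = 0"
    using \<open>c \<in> C\<close> by (simp add: dual_code_def)
  moreover have "(\<Sum>i<k'. (if i = r then 1 else 0) * H i j) = H r j" for j
    using \<open>r < k'\<close> by (simp add: if_distrib[of "\<lambda>x. x * _"] cong: if_cong)
  ultimately show ?thesis by (simp add: mult.commute)
qed

section \<open>List decoding and dual codes\<close>

text \<open>Clears the denominators so that the counting stays in the natural numbers, where the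
  assumption makes \<open>n - k - d\<close> the true difference.\<close>

lemma rLD_MDS_iff:
  fixes C :: "(nat \<Rightarrow> 'a::field) set"
  assumes "k + d \<le> n"
  shows "rLD_MDS n k d l C \<longleftrightarrow>
    (\<forall>y\<in>vecs n. \<forall>c. (\<forall>i\<le>l. c i \<in> C) \<longrightarrow> inj_on c {..l} \<longrightarrow>
      l * (n - k - d) < (\<Sum>i\<le>l. wt n (\<lambda>j. y j - c i j)))"
proof -
  have "real n - real k - real d = real (n - k - d)" using assms by linarith
  \<comment> \<open>For \<open>n = 0\<close> the quotient is 0 by convention, which agrees because
    \<open>n - k - d\<close> is then 0 as well.\<close>
  moreover from this have "real (n - k - d) / real n * real n = real (n - k - d)"
    by (cases "n = 0") auto
  ultimately have rhs: "real l / real (l + 1) * ((real n - real k - real d) / real n) * real n =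
      real (l * (n - k - d)) / real (l + 1)"
    by (simp add: mult.assoc)
  have "real l / real (l + 1) * ((real n - real k - real d) / real n) * real n
      < (\<Sum>i\<le>l. real (w i)) / real (l + 1) \<longleftrightarrow> l * (n - k - d) < (\<Sum>i\<le>l. w i)" for w :: "nat \<Rightarrow> nat"
  proof -
    have "(\<Sum>i\<le>l. real (w i)) = real (\<Sum>i\<le>l. w i)" by simp
    then show ?thesis
      unfolding rhs by (simp only: divide_less_cancel of_nat_less_iff) simp
  qed
  then show ?thesis unfolding rLD_MDS_def avg_list_dec_def by simp
qed

lemma rLD_MDS_index_set:
  fixes C :: "(nat \<Rightarrow> 'a::field) set" and c :: "'i \<Rightarrow> nat \<Rightarrow> 'a"
  assumes "k + d \<le> n" and ld: "rLD_MDS n k d l C" and y: "y \<in> vecs n"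
    and P: "card P = Suc l" and c: "\<And>i. i \<in> P \<Longrightarrow> c i \<in> C" and inj: "inj_on c P"
  shows "l * (n - k - d) < (\<Sum>i\<in>P. wt n (\<lambda>j. y j - c i j))"
proof -
  have "finite P" using P card_ge_0_finite by force
  then obtain e where e: "bij_betw e {..l} P"
    using ex_bij_betw_nat_finite[of P] P by (auto simp: atLeast0LessThan lessThan_Suc_atMost)
  have "inj_on (c \<circ> e) {..l}" using e inj by (metis bij_betw_def comp_inj_on)
  moreover have "\<forall>i\<le>l. (c \<circ> e) i \<in> C" using e c by (auto dest: bij_betwE)
  ultimately have "l * (n - k - d) < (\<Sum>i\<le>l. wt n (\<lambda>j. y j - (c \<circ> e) i j))"
    using ld[unfolded rLD_MDS_iff[OF assms(1)]] y by blast
  also have "\<dots> = (\<Sum>i\<in>P. wt n (\<lambda>j. y j - c i j))"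
    using sum.reindex_bij_betw[OF e, of "\<lambda>i. wt n (\<lambda>j. y j - c i j)"] by simp
  finally show ?thesis .
qed

text \<open>Where all words of \<open>P\<close> err, \<open>y\<close> is replaced by one of them,
  \<open>c p\<close>. No error set grows, since every word erred there already, and that of
  \<open>p\<close> loses the whole common part.\<close>

lemma reduce_common_errors:
  fixes y :: "nat \<Rightarrow> 'a::field" and c :: "'i \<Rightarrow> nat \<Rightarrow> 'a"
  assumes "finite P" "P \<noteq> {}" and y: "y \<in> vecs n"
  obtains y' where "y' \<in> vecs n"
    "(\<Inter>i\<in>P. {j. j < n \<and> y' j - c i j \<noteq> 0}) = {}"
    "(\<Sum>i\<in>P. wt n (\<lambda>j. y' j - c i j)) + card (\<Inter>i\<in>P. {j. j < n \<and> y j - c i j \<noteq> 0})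
      \<le> (\<Sum>i\<in>P. wt n (\<lambda>j. y j - c i j))"
proof -
  obtain p where p: "p \<in> P" using \<open>P \<noteq> {}\<close> by blast
  define E where "E i = {j. j < n \<and> y j - c i j \<noteq> 0}" for i
  define I where "I = (\<Inter>i\<in>P. E i)"
  define y' where "y' j = (if j \<in> I then c p j else y j)" for j
  define E' where "E' i = {j. j < n \<and> y' j - c i j \<noteq> 0}" for i
  have IE: "I \<subseteq> E i" if "i \<in> P" for i using that by (auto simp: I_def)
  have fin: "finite (E i)" for i by (simp add: E_def)
  have E'E: "E' i \<subseteq> E i" if "i \<in> P" for i
    using IE[OF that] by (auto simp: E'_def E_def y'_def)
  have E'p: "E' p = E p - I"
    using IE[OF p] by (auto simp: E'_def E_def y'_def)
  have "y' \<in> vecs n" using y IE[OF p] by (auto simp: vecs_def y'_def E_def)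
  moreover have "(\<Inter>i\<in>P. E' i) = {}"
  proof -
    have "x \<notin> (\<Inter>i\<in>P. E' i)" for x
    proof
      assume x: "x \<in> (\<Inter>i\<in>P. E' i)"
      have "x \<in> E i" if "i \<in> P" for i using E'E[OF that] x that by blast
      then have "x \<in> I" by (simp add: I_def)
      then show False using x p E'p by blast
    qed
    then show ?thesis by blast
  qed
  moreover have "(\<Sum>i\<in>P. card (E' i)) + card I \<le> (\<Sum>i\<in>P. card (E i))"
  proof -
    have "card (E' p) + card I = card (E p)"
      unfolding E'p using IE[OF p] fin by (simp add: card_Diff_subset card_mono finite_subset)
    moreover have "(\<Sum>i\<in>P - {p}. card (E' i)) \<le> (\<Sum>i\<in>P - {p}. card (E i))"
      using E'E fin by (intro sum_mono card_mono) auto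
    ultimately show ?thesis using \<open>finite P\<close> p by (simp add: sum.remove)
  qed
  ultimately show ?thesis
    using that[of y'] unfolding wt_def E_def E'_def I_def by blast
qed

lemma rMDS_dual_if_rLD_MDS_le:
  fixes C :: "(nat \<Rightarrow> 'a::field) set"
  assumes G: "gen_matrix n k G C" and kd: "k + d \<le> n" and ld: "rLD_MDS_le n k d L C"
  shows "rMDS TYPE('a) n (n - k) d (L + 1) (dual_code n C)"
  unfolding rMDS_def
proof (intro allI impI)
  fix H :: "nat \<Rightarrow> nat \<Rightarrow> 'a" and A :: "nat \<Rightarrow> nat set"
  let ?l = "L + 1" and ?m = "n - k - d"
  assume H: "gen_matrix n (n - k) H (dual_code n C)" and A: "\<forall>i<?l. A i \<subseteq> {..<n}"
    and gen: "blk_full_rank ?l ?m A (generic_mat :: nat \<Rightarrow> nat \<Rightarrow> 'a ratfun)"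
  have fin: "\<forall>i<?l. finite (A i)" using A finite_subset by blast
  show "blk_full_rank ?l (n - k) A H"
    unfolding blk_full_rank_iff[OF fin]
  proof (intro allI impI)
    fix s :: "nat \<Rightarrow> 'a" and x :: "nat \<Rightarrow> nat \<Rightarrow> 'a"
    assume sx: "\<forall>i<?l. \<forall>r<n - k. s r + (\<Sum>a\<in>A i. H r a * x i a) = 0"
    define y where "y i = (\<lambda>a. if a \<in> A i then x i a else 0)" for i
    have yv: "y i \<in> vecs n" if "i < ?l" for i using A that by (force simp: y_def vecs_def)
    have syn: "(\<Sum>a<n. H r a * y i a) = - s r" if "i < ?l" "r < n - k" for i r
    proof -
      have "(\<Sum>a<n. H r a * y i a) = (\<Sum>a\<in>A i. H r a * x i a)"
        using A that(1) by (intro sum.mono_neutral_cong_right) (auto simp: y_def)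
      then show ?thesis using sx that by (simp add: add_eq_0_iff)
    qed
    have diffC: "(\<lambda>a. y i a - y j a) \<in> C" if "i < ?l" "j < ?l" for i j
    proof (rule code_mem_if_parity_checks[OF G H])
      show "(\<lambda>a. y i a - y j a) \<in> vecs n" using yv that by (simp add: vecs_def)
      show "\<forall>r<n - k. (\<Sum>a<n. H r a * (y i a - y j a)) = 0"
        using syn that by (simp add: right_diff_distrib sum_subtractf)
    qed
    \<comment> \<open>List decoding speaks of distinct codewords, so blocks with equal
      \<open>y i\<close> are merged: \<open>e\<close> enumerates the \<open>q\<close> distinct
      values and \<open>f\<close> sends a block to the index of its value.\<close>
    define Y where "Y = y ` {..<?l}"
    define q where "q = card Y"
    have finY: "finite Y" by (simp add: Y_def)
    obtain e where e: "bij_betw e {..<q} Y"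
      using ex_bij_betw_nat_finite[OF finY] by (auto simp: q_def atLeast0LessThan)
    define f where "f i = inv_into {..<q} e (y i)" for i
    have ef: "e (f i) = y i" if "i < ?l" for i
      using e that unfolding f_def by (intro bij_betw_inv_into_right) (auto simp: Y_def)
    have fq: "f ` {..<?l} = {..<q}"
      using bij_betw_imp_surj_on[OF bij_betw_inv_into[OF e]]
      by (simp add: f_def Y_def image_image)
    have "y 0 \<in> Y" by (simp add: Y_def)
    then have "q \<noteq> 0" using finY by (auto simp: q_def)
    have "q \<le> ?l" using card_image_le[of "{..<?l}" y] by (simp add: q_def Y_def)
    define B where "B j = (\<Inter>i\<in>{i. i < ?l \<and> f i = j}. A i)" for j
    have ex: "\<exists>i<?l. f i = j" if "j < q" for j using fq that by (metis imageE lessThan_iff)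
    have finB: "\<forall>j<q. finite (B j)"
    proof (intro allI impI)
      fix j assume "j < q"
      then obtain i where "i < ?l" "f i = j" using ex by blast
      then show "finite (B j)" using fin by (auto simp: B_def intro: finite_subset[of _ "A i"])
    qed
    have "blk_full_rank q ?m B (generic_mat :: nat \<Rightarrow> nat \<Rightarrow> 'a ratfun)"
      unfolding B_def using blk_full_rank_merge[OF fin gen fq] .
    then have cards: "?m + (\<Sum>j<q. card (B j)) \<le> q * ?m"
      by (rule blk_full_rank_card_le[OF finB])
    \<comment> \<open>A value shared by several blocks is supported in each of their sets, hence in
      the intersection.\<close>
    have wtB: "wt n (e j) \<le> card (B j)" if "j < q" for j
      unfolding wt_def
    proof (rule card_mono)
      show "finite (B j)" using finB that by blast
      show "{a. a < n \<and> e j a \<noteq> 0} \<subseteq> B j"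
        using ef by (auto simp: B_def y_def split: if_splits)
    qed
    then have wts: "(\<Sum>j<q. wt n (e j)) \<le> (\<Sum>j<q. card (B j))" by (intro sum_mono) auto
    have e_zero: "\<forall>j<q. \<forall>a<n. e j a = 0"
    proof (cases "q = 1")
      \<comment> \<open>A single value gives no list to decode, but \<open>cards\<close> then leaves
        \<open>B 0\<close> empty.\<close>
      case True
      then have "wt n (e 0) = 0" using cards wts by simp
      then show ?thesis using True by (auto simp: wt_def)
    next
      case False
      let ?t = "q - 1"
      have "?t \<in> {1..L}" using False \<open>q \<noteq> 0\<close> \<open>q \<le> ?l\<close> by auto
      then have ldt: "rLD_MDS n k d ?t C" using ld by (simp add: rLD_MDS_le_def)
      obtain i0 where i0: "i0 < ?l" "f i0 = 0" using ex[of 0] \<open>q \<noteq> 0\<close> by auto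
      then have e0: "e 0 = y i0" using ef by metis
      \<comment> \<open>With received word \<open>e 0\<close> and codewords \<open>e 0 - e j\<close>
        the errors are the \<open>e j\<close> themselves. The lower bound on their weights
        contradicts \<open>cards\<close>.\<close>
      have "?t * ?m < (\<Sum>j<q. wt n (\<lambda>a. e 0 a - (e 0 a - e j a)))"
      proof (rule rLD_MDS_index_set[OF kd ldt])
        show "e 0 \<in> vecs n" using e0 yv i0 by simp
        show "card {..<q} = Suc ?t" using \<open>q \<noteq> 0\<close> by simp
        show "(\<lambda>a. e 0 a - e j a) \<in> C" if "j \<in> {..<q}" for j
          using ex[of j] that ef e0 diffC i0 by auto
        show "inj_on (\<lambda>j a. e 0 a - e j a) {..<q}"
        proof (rule inj_onI)
          fix i j assume ij: "i \<in> {..<q}" "j \<in> {..<q}" "(\<lambda>a. e 0 a - e i a) = (\<lambda>a. e 0 a - e j a)"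
          have "e i a = e j a" for a using fun_cong[OF ij(3), of a] by simp
          then have "e i = e j" by blast
          then show "i = j" using e ij by (auto simp: bij_betw_def inj_on_def)
        qed
      qed
      then have "?t * ?m < (\<Sum>j<q. card (B j))" using wts by simp
      moreover have "q * ?m = ?m + ?t * ?m" using \<open>q \<noteq> 0\<close> by (cases q) auto
      ultimately show ?thesis using cards by simp
    qed
    have x0: "x i a = 0" if "i < ?l" "a \<in> A i" for i a
    proof -
      have "f i < q" "a < n" using that fq A by auto
      then have "y i a = 0" using e_zero ef[OF that(1)] by metis
      then show ?thesis using that by (simp add: y_def)
    qed
    moreover have "s r = 0" if "r < n - k" for r
    proof -
      have "s r + (\<Sum>a\<in>A 0. H r a * x 0 a) = 0" using sx that by simp
      then show ?thesis using x0 by simp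
    qed
    ultimately show "(\<forall>r<n - k. s r = 0) \<and> (\<forall>i<?l. \<forall>a\<in>A i. x i a = 0)" by blast
  qed
qed

lemma rLD_MDS_le_if_rMDS_dual:
  fixes C :: "(nat \<Rightarrow> 'a::field) set"
  assumes G: "gen_matrix n k G C" and kd: "k + d \<le> n"
    and mds: "rMDS TYPE('a) n (n - k) d (L + 1) (dual_code n C)"
  shows "rLD_MDS_le n k d L C"
proof -
  let ?m = "n - k - d"
  obtain H where H: "gen_matrix n (n - k) H (dual_code n C)"
    using dual_code_gen_matrix(2)[OF G] by blast
  have "rLD_MDS n k d l C" if "1 \<le> l" "l \<le> L" for l
    using that
  \<comment> \<open>The induction hypothesis expresses minimality of the violation: it supplies the
    inequalities for proper subfamilies.\<close>
  proof (induction l rule: less_induct)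
    case (less l)
    show ?case
      unfolding rLD_MDS_iff[OF kd]
    proof (intro ballI allI impI, rule ccontr)
      fix y0 :: "nat \<Rightarrow> 'a" and c :: "nat \<Rightarrow> nat \<Rightarrow> 'a"
      assume y0: "y0 \<in> vecs n" and c: "\<forall>i\<le>l. c i \<in> C" and inj: "inj_on c {..l}"
        and "\<not> l * ?m < (\<Sum>i\<le>l. wt n (\<lambda>j. y0 j - c i j))"
      then have viol0: "(\<Sum>i\<le>l. wt n (\<lambda>j. y0 j - c i j)) \<le> l * ?m" by simp
      \<comment> \<open>Correcting the errors common to all codewords keeps the violation and makes
        the total intersection empty.\<close>
      obtain y where y: "y \<in> vecs n" "(\<Inter>i\<le>l. {j. j < n \<and> y j - c i j \<noteq> 0}) = {}"
        "(\<Sum>i\<le>l. wt n (\<lambda>j. y j - c i j)) + card (\<Inter>i\<le>l. {j. j < n \<and> y0 j - c i j \<noteq> 0})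
          \<le> (\<Sum>i\<le>l. wt n (\<lambda>j. y0 j - c i j))"
        using reduce_common_errors[of "{..l}" y0 n c] y0 by blast
      define A where "A i = {j. j < n \<and> y j - c i j \<noteq> 0}" for i
      have finA: "finite (A i)" for i by (simp add: A_def)
      have cardA: "card (A i) = wt n (\<lambda>j. y j - c i j)" for i by (simp add: A_def wt_def)
      have "blk_full_rank (Suc l) ?m A (generic_mat :: nat \<Rightarrow> nat \<Rightarrow> 'a ratfun)"
      proof (rule blk_full_rank_generic_of_card_sums)
        show "(\<Sum>i\<le>l. card (A i)) \<le> l * ?m" using y(3) viol0 by (simp add: cardA)
        show "(\<Inter>i\<le>l. A i) = {}" using y(2) by (simp add: A_def)
        fix P assume P: "P \<subset> {..l}" "P \<noteq> {}"
        have finP: "finite P" using P finite_subset by blast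
        have "card P < card {..l}" using P by (intro psubset_card_mono) auto
        then have "card P \<le> l" by simp
        show "(card P - 1) * ?m + card (\<Inter>i\<in>P. A i) \<le> (\<Sum>i\<in>P. card (A i))"
        proof (cases "card P = 1")
          case True
          then obtain p where "P = {p}" by (metis card_1_singletonE)
          then show ?thesis by simp
        next
          case False
          have "card P \<noteq> 0" using finP P by simp
          with False have "card P = Suc (card P - 1)" "1 \<le> card P - 1" "card P - 1 < l"
            using \<open>card P \<le> l\<close> by linarith+
          note cP = this
          \<comment> \<open>A list parameter is one less than the number of codewords, so
            \<open>P\<close> calls for \<open>card P - 1\<close>, which is at least 1 and below
            \<open>l\<close>.\<close>
          have ldP: "rLD_MDS n k d (card P - 1) C"
            using less.IH[OF cP(3) cP(2)] cP(3) less.prems by simp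
          \<comment> \<open>Decodability applies to the corrected word; the errors saved become the
            intersection term.\<close>
          obtain y' where y': "y' \<in> vecs n" "(\<Inter>i\<in>P. {j. j < n \<and> y' j - c i j \<noteq> 0}) = {}"
            "(\<Sum>i\<in>P. wt n (\<lambda>j. y' j - c i j)) + card (\<Inter>i\<in>P. A i) \<le> (\<Sum>i\<in>P. card (A i))"
            using reduce_common_errors[OF finP P(2) y(1), of c, folded A_def cardA] .
          have "(card P - 1) * ?m < (\<Sum>i\<in>P. wt n (\<lambda>j. y' j - c i j))"
            using c inj P by (intro rLD_MDS_index_set[OF kd ldP y'(1) cP(1)])
              (auto intro: inj_on_subset)
          then show ?thesis using y'(3) by simp
        qed
      qed (use less.prems finA in auto)
      then have "blk_full_rank (L + 1) ?m (\<lambda>i. A (if i < Suc l then i else 0))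
          (generic_mat :: nat \<Rightarrow> nat \<Rightarrow> 'a ratfun)"
        using less.prems finA by (intro blk_full_rank_pad) auto
      moreover have "\<forall>i<L + 1. A (if i < Suc l then i else 0) \<subseteq> {..<n}" by (auto simp: A_def)
      ultimately have full: "blk_full_rank (L + 1) (n - k) (\<lambda>i. A (if i < Suc l then i else 0)) H"
        by (intro mds[unfolded rMDS_def, THEN spec, THEN spec, THEN mp, THEN mp, THEN mp] H)
      have fin': "\<forall>i<L + 1. finite (A (if i < Suc l then i else 0))" using finA by simp
      let ?c = "\<lambda>i. c (if i < Suc l then i else 0)"
      \<comment> \<open>The error vectors \<open>y - ?c i\<close> share the syndrome of
        \<open>y\<close>; together with its negative they form a kernel vector over
        \<open>H\<close>.\<close>
      have "\<forall>i<L + 1. \<forall>r<n - k. - (\<Sum>a<n. H r a * y a) +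
          (\<Sum>a\<in>A (if i < Suc l then i else 0). H r a * (y a - ?c i a)) = 0"
      proof (intro allI impI)
        fix i r assume "i < L + 1" and r: "r < n - k"
        have "?c i \<in> C" using c by simp
        then have "(\<Sum>a<n. H r a * ?c i a) = 0" using dual_gen_matrix_orthogonal[OF H] r by blast
        moreover have "(\<Sum>a\<in>A (if i < Suc l then i else 0). H r a * (y a - ?c i a)) =
            (\<Sum>a<n. H r a * (y a - ?c i a))"
          by (intro sum.mono_neutral_left) (auto simp: A_def)
        ultimately show "- (\<Sum>a<n. H r a * y a) +
          (\<Sum>a\<in>A (if i < Suc l then i else 0). H r a * (y a - ?c i a)) = 0"
          by (simp add: right_diff_distrib sum_subtractf)
      qed
      then have zero: "\<forall>i<L + 1. \<forall>a\<in>A (if i < Suc l then i else 0). y a - ?c i a = 0"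
        using full[unfolded blk_full_rank_iff[OF fin'], THEN spec, THEN spec, THEN mp,
            of "\<lambda>r. - (\<Sum>a<n. H r a * y a)" "\<lambda>i a. y a - ?c i a"]
        by blast
      have agree: "y a = c i a" if "i \<le> l" "a < n" for i a
      proof (rule ccontr)
        assume "y a \<noteq> c i a"
        then have "a \<in> A i" using that by (simp add: A_def)
        then show False using zero[rule_format, of i a] that less.prems \<open>y a \<noteq> c i a\<close> by simp
      qed
      \<comment> \<open>All errors vanish, so every codeword equals \<open>y\<close>. Since
        \<open>l \<ge> 1\<close>, the list contains two, which \<open>inj\<close> requires to
        differ.\<close>
      have "c 0 = c 1"
      proof
        fix a
        have "c 0 \<in> vecs n" "c 1 \<in> vecs n" using c less.prems code_subset_vecs[OF G] by auto
        then show "c 0 a = c 1 a"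
          using agree[of 0 a] agree[of 1 a] less.prems by (cases "a < n") (auto simp: vecs_def)
      qed
      then show False using inj less.prems by (auto simp: inj_on_def)
    qed
  qed
  then show ?thesis by (simp add: rLD_MDS_le_def)
qed

theorem theorem3p11:
  fixes C :: "(nat \<Rightarrow> 'a::field) set" and n k d L :: nat
  assumes "is_code n k C" and "L \<ge> 1" and "d \<le> n - k"
  shows "rLD_MDS_le n k d L C \<longleftrightarrow> rMDS TYPE('a) n (n - k) d (L + 1) (dual_code n C)"
proof -
  obtain G where G: "gen_matrix n k G C" using assms(1) by (auto simp: is_code_def)
  \<comment> \<open>The assumption on \<open>d\<close> uses truncated subtraction;
    \<open>k \<le> n\<close>, valid for every code, turns it into the true inequality.\<close>
  have "k + d \<le> n" using dual_code_gen_matrix(1)[OF G] assms(3) by simp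
  then show ?thesis
    using rMDS_dual_if_rLD_MDS_le[OF G] rLD_MDS_le_if_rMDS_dual[OF G] by blast
qed

end
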